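(* Let $\{b_k\}_{k=1}^\infty$ and $\{N_k\}_{k=1}^\infty$ be two sequences of positive integers satisfying $N_k \ge b_k \ge 2$ and $b_k \mid N_k$ for every $k \ge 1$. Suppose that $\{B_k\}_{k=1}^\infty$ is a sequence of nearly consecutive digit sets with respect to $\{b_k\}$ and $\{N_k\}$. Then the infinite convolution $$\mu = \delta_{N_1^{-1} B_1} * \delta_{(N_1N_2)^{-1} B_2} * \cdots * \delta_{(N_1N_2\cdots N_n)^{-1} B_n} * \cdots$$ exists, and moreover, $\mu$ is a spectral measure.
   Context: Notation: $\#$ denotes the cardinality of a set. For a finite nonempty set $A \subseteq \mathbb{R}$, $\delta_A = \frac{1}{\# A} \sum_{a \in A} \delta_a$, where $\delta_a$ is the Dirac measure at $a$; for $t \in \mathbb{R}$, $tA = \{ta : a\in A\}$; $*$ denotes convolution of measures. Infinite convolution: given finite sets $A_k\subseteq\mathbb{R}$ with $\#A_k \ge 2$, the infinite convolution $\delta_{A_1} * \delta_{A_2} * \cdots$ is said to exist if the finite convolutions $\delta_{A_1} * \cdots * \delta_{A_n}$ converge weakly (i.e. tested against bounded continuous functions) to a Borel probability measure as $n\to\infty$, and it then denotes this weak limit. Nearly consecutive digit sets: let $\{b_k\}$, $\{N_k\}$ be sequences of positive integers with $N_k \ge b_k \ge 2$ and $b_k \mid N_k$, and let $\{B_k\}$ be a sequence of finite subsets of nonnegative integers. $\{B_k\}$ is a sequence of nearly consecutive digit sets with respect to $\{b_k\}$ and $\{N_k\}$ if for every $k\ge1$ $$B_k \equiv \{0,1,2,\ldots,b_k-1\}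 \pmod{N_k},$$ meaning that reduction modulo $N_k$ maps $B_k$ bijectively onto the residue classes of $0,1,\ldots,b_k-1$ (so $\# B_k = b_k$), and $$\sum_{k=1}^\infty \frac{1}{b_k} \#\big(B_k \setminus \{0,1,2,\ldots,b_k-1\}\big) < \infty.$$ Spectral measure: a Borel probability measure $\nu$ on $\mathbb{R}$ is a spectral measure if there exists a countable set $\Lambda \subseteq \mathbb{R}$ such that the family of functions $\{x \mapsto e^{-2\pi i \lambda x} : \lambda \in \Lambda\}$ forms an orthonormal basis of $L^2(\nu)$. *)

theory Defs
  imports "HOL-Probability.Probability"
begin

text \<open>All sequences are indexed from 0: the entry with index \<open>k\<close> is the mathematical entry with
  index \<open>k + 1\<close>.\<close>

section \<open>Uniform measures on finite sets and infinite convolutions\<close>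

definition uniform_delta :: "real set \<Rightarrow> real measure" where
  "uniform_delta A = distr (uniform_count_measure A) borel (\<lambda>x. x)"

text \<open>On Borel sets this is \<open>1 / #A\<close> times the sum of the Dirac measures at the points of \<open>A\<close>.\<close>

lemma emeasure_uniform_delta:
  assumes "finite A" "A \<noteq> {}" "E \<in> sets borel"
  shows "emeasure (uniform_delta A) E
           = ennreal (1 / real (card A)) * (\<Sum>a\<in>A. emeasure (return borel a) E)"
proof -
  have m: "(\<lambda>x. x) \<in> measurable (uniform_count_measure A) (borel :: real measure)"
    by (simp add: measurable_def space_uniform_count_measure sets_uniform_count_measure)
  have "emeasure (uniform_delta A) E = ennreal (real (card (E \<inter> A)) / real (card A))"
    using assms m
    by (simp add: uniform_delta_def emeasure_distr space_uniform_count_measure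
        emeasure_uniform_count_measure)
  moreover have "(\<Sum>a\<in>A. emeasure (return borel a) E) = ennreal (real (card (E \<inter> A)))"
    using assms
    by (simp add: indicator_def sum.If_cases Int_commute ennreal_of_nat_eq_real_of_nat)
  ultimately show ?thesis
    by (simp add: ennreal_mult'[symmetric])
qed

primrec finite_convolution :: "(nat \<Rightarrow> real measure) \<Rightarrow> nat \<Rightarrow> real measure" where
  "finite_convolution M 0 = M 0"
| "finite_convolution M (Suc n) = convolution (finite_convolution M n) (M (Suc n))"

definition converges_weakly :: "(nat \<Rightarrow> real measure) \<Rightarrow> real measure \<Rightarrow> bool" where
  "converges_weakly M \<nu> \<longleftrightarrow>
     (\<forall>f :: real \<Rightarrow> real. continuous_on UNIV f \<and> bounded (range f) \<longrightarrow>
        (\<lambda>n. integral\<^sup>L (M n) f) \<longlonglongrightarrow> integral\<^sup>L \<nu> f)"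

text \<open>The locale predicate \<^const>\<open>real_distribution\<close> says that a measure is a Borel probability
  measure on the real line.\<close>

definition is_infinite_convolution :: "(nat \<Rightarrow> real set) \<Rightarrow> real measure \<Rightarrow> bool" where
  "is_infinite_convolution A \<nu> \<longleftrightarrow>
     real_distribution \<nu> \<and> converges_weakly (finite_convolution (\<lambda>k. uniform_delta (A k))) \<nu>"

definition infinite_convolution_exists :: "(nat \<Rightarrow> real set) \<Rightarrow> bool" where
  "infinite_convolution_exists A \<longleftrightarrow> (\<exists>\<nu>. is_infinite_convolution A \<nu>)"

definition infinite_convolution :: "(nat \<Rightarrow> real set) \<Rightarrow> real measure" where
  "infinite_convolution A = (THE \<nu>. is_infinite_convolution A \<nu>)"

lemma converges_weakly_unique:
  assumes "real_distribution \<nu>1" "real_distribution \<nu>2"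
    and "converges_weakly M \<nu>1" "converges_weakly M \<nu>2"
  shows "\<nu>1 = \<nu>2"
proof -
  have eq: "integral\<^sup>L \<nu>1 f = integral\<^sup>L \<nu>2 f"
    if "\<And>x. isCont f x" "\<And>x. \<bar>f x\<bar> \<le> 1" for f :: "real \<Rightarrow> real"
  proof (rule LIMSEQ_unique)
    have "continuous_on UNIV f" "bounded (range f)"
      using that by (auto simp: continuous_on_eq_continuous_at bounded_iff)
    then show "(\<lambda>n. integral\<^sup>L (M n) f) \<longlonglongrightarrow> integral\<^sup>L \<nu>1 f"
      "(\<lambda>n. integral\<^sup>L (M n) f) \<longlonglongrightarrow> integral\<^sup>L \<nu>2 f"
      using assms(3,4) by (auto simp: converges_weakly_def)
  qed
  have "weak_conv_m (\<lambda>_. \<nu>1) \<nu>2"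
    by (rule integral_bdd_continuous_conv_imp_weak_conv) (use assms(1,2) eq in auto)
  then have "(\<lambda>_. char \<nu>1 t) \<longlonglongrightarrow> char \<nu>2 t" for t
    using assms(1,2) levy_continuity1[of "\<lambda>_. \<nu>1" \<nu>2 t] by simp
  then have "char \<nu>1 = char \<nu>2"
    by (auto simp: LIMSEQ_const_iff)
  then show ?thesis
    using Levy_uniqueness assms(1,2) by blast
qed

lemma infinite_convolution_eqI:
  "is_infinite_convolution A \<nu> \<Longrightarrow> infinite_convolution A = \<nu>"
  unfolding infinite_convolution_def is_infinite_convolution_def
  by (rule the_equality) (auto intro: converges_weakly_unique)

section \<open>Nearly consecutive digit sets\<close>

definition nearly_consecutive ::
    "(nat \<Rightarrow> nat) \<Rightarrow> (nat \<Rightarrow> nat) \<Rightarrow> (nat \<Rightarrow> nat set) \<Rightarrow> bool" where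
  "nearly_consecutive b N B \<longleftrightarrow>
     (\<forall>k. finite (B k) \<and> bij_betw (\<lambda>x. x mod N k) (B k) {0..<b k}) \<and>
     summable (\<lambda>k. 1 / real (b k) * real (card (B k - {0..<b k})))"

section \<open>Spectral measures\<close>

text \<open>Elements of \<open>L\<^sup>2\<close> are represented by functions, without passing to classes modulo null
  sets; the notions below do not depend on the representative.\<close>

definition square_integrable :: "real measure \<Rightarrow> (real \<Rightarrow> complex) \<Rightarrow> bool" where
  "square_integrable \<nu> f \<longleftrightarrow>
     f \<in> borel_measurable \<nu> \<and> integrable \<nu> (\<lambda>x. (cmod (f x))\<^sup>2)"

definition l2_inner :: "real measure \<Rightarrow> (real \<Rightarrow> complex) \<Rightarrow> (real \<Rightarrow> complex) \<Rightarrow> complex" where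
  "l2_inner \<nu> f g = (LINT x|\<nu>. f x * cnj (g x))"

definition l2_norm :: "real measure \<Rightarrow> (real \<Rightarrow> complex) \<Rightarrow> real" where
  "l2_norm \<nu> f = sqrt (LINT x|\<nu>. (cmod (f x))\<^sup>2)"

text \<open>Orthonormal basis in the Hilbert space sense: an orthonormal family whose finite linear
  combinations are dense.\<close>

definition l2_orthonormal_basis ::
    "real measure \<Rightarrow> 'i set \<Rightarrow> ('i \<Rightarrow> real \<Rightarrow> complex) \<Rightarrow> bool" where
  "l2_orthonormal_basis \<nu> I e \<longleftrightarrow>
     (\<forall>i\<in>I. square_integrable \<nu> (e i)) \<and>
     (\<forall>i\<in>I. \<forall>j\<in>I. l2_inner \<nu> (e i) (e j) = (if i = j then 1 else 0)) \<and>
     (\<forall>f. square_integrable \<nu> f \<longrightarrow>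
        (\<forall>\<epsilon>>0. \<exists>F c. finite F \<and> F \<subseteq> I \<and>
           l2_norm \<nu> (\<lambda>x. f x - (\<Sum>i\<in>F. c i * e i x)) < \<epsilon>))"

definition spectral_measure :: "real measure \<Rightarrow> bool" where
  "spectral_measure \<nu> \<longleftrightarrow>
     real_distribution \<nu> \<and>
     (\<exists>\<Lambda> :: real set. countable \<Lambda> \<and>
        l2_orthonormal_basis \<nu> \<Lambda> (\<lambda>t x. exp (- 2 * of_real pi * \<i> * of_real t * of_real x)))"

end

theory Submission
  imports Defs "HOL-Real_Asymp.Real_Asymp"
begin

text \<open>Write \<open>Q n\<close> for the product of the first \<open>n\<close> moduli and \<open>phi n\<close> for the Fourier transform of the
  convolution of the first \<open>n\<close> factors; it is \<open>Q n\<close>-periodic. Since \<open>B k\<close> is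
  congruent to \<open>{0..<b k}\<close>, the multiples of \<open>N k / b k\<close> form a spectrum of the \<open>k\<close>-th digit set, and
  the sums of such frequencies can be replaced by their representatives in \<open>[- Q n / 2, Q n / 2)\<close>.
  This gives increasing sets \<open>Lam n\<close> with \<open>\<Sum>l\<in>Lam n. |phi n (l + x)|\<^sup>2 = 1\<close> for all \<open>x\<close>, which already
  contains the orthogonality of the exponentials. Because the representatives are balanced, the
  remaining factors of the limit transform at \<open>l + x\<close> are evaluated within slightly more than half
  a period; for consecutive digits their product is bounded below there, and the nearly consecutive
  condition makes the error of this comparison summable. Dominated convergence then yields
  \<open>\<Sum>l. |phi_lim (l + x)|\<^sup>2 = 1\<close> over the union of all \<open>Lam n\<close>, that is, every exponential lies in the
  closed span of the orthonormal family. As \<open>x\<close> ranges over all reals, this suffices even though the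
  limit measure need not have compact support: trigonometric polynomials with arbitrary real
  frequencies are dense in \<open>L\<^sup>2\<close> of any probability measure on the line.\<close>

section \<open>Approximation in mean square by exponentials\<close>

text \<open>Closeness is measured by the squared distance, so that \<open>norm_add_sq_le\<close> can
  stand in for the triangle inequality in the \<open>L\<^sup>2\<close> norm.\<close>

definition l2_closure :: "real measure \<Rightarrow> (real \<Rightarrow> complex) set \<Rightarrow> (real \<Rightarrow> complex) set" where
  "l2_closure M S = {f. square_integrable M f \<and>
     (\<forall>\<epsilon>>0. \<exists>g\<in>S. square_integrable M g \<and> (LINT x|M. (cmod (f x - g x))\<^sup>2) < \<epsilon>)}"

section \<open>Exponentials and trigonometric polynomials\<close>

definition expo :: "real \<Rightarrow> real \<Rightarrow> complex" where
  "expo t x = exp (- 2 * of_real pi * \<i> * of_real t * of_real x)"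

lemma expo_cis: "expo t x = cis (- 2 * pi * t * x)"
  by (simp add: expo_def cis_conv_exp mult_ac)

lemma norm_expo [simp]: "cmod (expo t x) = 1"
  by (simp add: expo_cis)

lemma expo_mult: "expo s x * expo t x = expo (s + t) x"
  by (simp add: expo_cis cis_mult algebra_simps)

lemma cnj_expo: "cnj (expo t x) = expo (- t) x"
  by (simp add: expo_cis cis_cnj)

lemma expo_0 [simp]: "expo 0 x = 1"
  by (simp add: expo_def)

lemma continuous_expo: "continuous_on UNIV (expo t)"
  unfolding expo_def by (intro continuous_intros)

lemma borel_measurable_expo [measurable]: "expo t \<in> borel_measurable borel"
  by (intro borel_measurable_continuous_onI continuous_expo)

text \<open>Frequencies are arbitrary reals, which makes the set closed under products; the
  inductive form turns every closure property into an induction.\<close>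

inductive_set trig_polys :: "(real \<Rightarrow> complex) set" where
  expo: "expo t \<in> trig_polys"
| scale: "p \<in> trig_polys \<Longrightarrow> (\<lambda>x. c * p x) \<in> trig_polys"
| add: "p \<in> trig_polys \<Longrightarrow> q \<in> trig_polys \<Longrightarrow> (\<lambda>x. p x + q x) \<in> trig_polys"

lemma trig_polys_mult_expo:
  "p \<in> trig_polys \<Longrightarrow> (\<lambda>x. p x * expo t x) \<in> trig_polys"
proof (induction rule: trig_polys.induct)
  case (expo s)
  then show ?case using trig_polys.expo[of "s + t"] by (simp add: expo_mult)
next
  case (scale p c)
  then show ?case using trig_polys.scale[of "\<lambda>x. p x * expo t x" c] by (simp add: mult_ac)
next
  case (add p q)
  then show ?case
    using trig_polys.add[of "\<lambda>x. p x * expo t x" "\<lambda>x. q x * expo t x"] by (simp add: algebra_simps)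
qed

lemma trig_polys_mult:
  "q \<in> trig_polys \<Longrightarrow> p \<in> trig_polys \<Longrightarrow> (\<lambda>x. p x * q x) \<in> trig_polys"
proof (induction rule: trig_polys.induct)
  case (expo s)
  then show ?case by (rule trig_polys_mult_expo)
next
  case (scale q c)
  then show ?case using trig_polys.scale[of "\<lambda>x. p x * q x" c] by (simp add: mult_ac)
next
  case (add q q')
  then show ?case
    using trig_polys.add[of "\<lambda>x. p x * q x" "\<lambda>x. p x * q' x"] by (simp add: algebra_simps)
qed

lemma trig_polys_bounded: "p \<in> trig_polys \<Longrightarrow> \<exists>C>0. \<forall>x. cmod (p x) \<le> C"
proof (induction rule: trig_polys.induct)
  case (expo t)
  then show ?case by (intro exI[of _ 1]) auto
next
  case (scale p c)
  then obtain C where C: "C > 0" "\<And>x. cmod (p x) \<le> C" by blast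
  have "cmod (c * p x) \<le> (cmod c + 1) * C" for x
    unfolding norm_mult using C by (intro mult_mono) auto
  then show ?case using C by (intro exI[of _ "(cmod c + 1) * C"]) (auto intro!: mult_pos_pos add_nonneg_pos)
next
  case (add p q)
  then obtain C D where "C > 0" "\<And>x. cmod (p x) \<le> C" "D > 0" "\<And>x. cmod (q x) \<le> D" by blast
  then show ?case
    by (intro exI[of _ "C + D"]) (auto intro!: norm_triangle_le add_mono)
qed

lemma trig_polys_measurable: "p \<in> trig_polys \<Longrightarrow> p \<in> borel_measurable borel"
  by (induction rule: trig_polys.induct) auto

lemma one_in_trig_polys: "(\<lambda>x. 1) \<in> trig_polys"
proof -
  have "expo 0 = (\<lambda>x. 1)" by (rule ext) simp
  then show ?thesis using trig_polys.expo[of 0] by simp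
qed

lemma sin_in_trig_polys: "(\<lambda>x. complex_of_real (sin (c * x + d))) \<in> trig_polys"
proof -
  have "complex_of_real (sin (c * x + d)) =
      (- \<i> / 2 * cis d) * expo (- c / (2 * pi)) x + (\<i> / 2 * cis (- d)) * expo (c / (2 * pi)) x" for x
    by (simp add: expo_cis complex_eq_iff cos_add sin_add algebra_simps) (simp add: field_simps)
  then show ?thesis
    using trig_polys.add[OF trig_polys.scale[OF trig_polys.expo[of "- c / (2 * pi)"], of "- \<i> / 2 * cis d"]
      trig_polys.scale[OF trig_polys.expo[of "c / (2 * pi)"], of "\<i> / 2 * cis (- d)"]]
    by simp
qed

lemma norm_add_sq_le: "(cmod (a + b))\<^sup>2 \<le> 2 * (cmod a)\<^sup>2 + 2 * (cmod b)\<^sup>2"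
proof -
  have "(cmod (a + b))\<^sup>2 \<le> (cmod a + cmod b)\<^sup>2"
    by (intro power_mono norm_triangle_ineq) auto
  also have "\<dots> \<le> 2 * (cmod a)\<^sup>2 + 2 * (cmod b)\<^sup>2"
    using zero_le_power2[of "cmod a - cmod b"] by (simp add: power2_eq_square algebra_simps)
  finally show ?thesis .
qed

section \<open>Closure operations in mean square\<close>

context real_distribution
begin

lemma square_integrable_iff:
  "square_integrable M f \<longleftrightarrow> f \<in> borel_measurable borel \<and> integrable M (\<lambda>x. (cmod (f x))\<^sup>2)"
  by (simp add: square_integrable_def measurable_cong_sets[OF events_eq_borel refl])

lemma square_integrable_add:
  assumes "square_integrable M f" "square_integrable M g"
  shows "square_integrable M (\<lambda>x. f x + g x)"
proof -
  have m: "f \<in> borel_measurable borel" "g \<in> borel_measurable borel"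
    using assms by (auto simp: square_integrable_iff)
  have "integrable M (\<lambda>x. (cmod (f x + g x))\<^sup>2)"
  proof (rule Bochner_Integration.integrable_bound)
    show "integrable M (\<lambda>x. 2 * (cmod (f x))\<^sup>2 + 2 * (cmod (g x))\<^sup>2)"
      using assms by (auto simp: square_integrable_iff)
    show "AE x in M. norm ((cmod (f x + g x))\<^sup>2) \<le> norm (2 * (cmod (f x))\<^sup>2 + 2 * (cmod (g x))\<^sup>2)"
      by (auto intro!: AE_I2 norm_add_sq_le)
  qed (use m in measurable)
  then show ?thesis using m by (auto simp: square_integrable_iff)
qed

lemma square_integrable_mult:
  assumes "square_integrable M f" "g \<in> borel_measurable borel" "\<And>x. cmod (g x) \<le> C"
  shows "square_integrable M (\<lambda>x. g x * f x)"
proof -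
  have m: "f \<in> borel_measurable borel" "g \<in> borel_measurable borel"
    using assms by (auto simp: square_integrable_iff)
  have "integrable M (\<lambda>x. (cmod (g x * f x))\<^sup>2)"
  proof (rule Bochner_Integration.integrable_bound)
    show "integrable M (\<lambda>x. C\<^sup>2 * (cmod (f x))\<^sup>2)"
      using assms by (auto simp: square_integrable_iff)
    show "AE x in M. norm ((cmod (g x * f x))\<^sup>2) \<le> norm (C\<^sup>2 * (cmod (f x))\<^sup>2)"
      using assms(3) by (auto intro!: AE_I2 mult_right_mono power_mono simp: norm_mult power_mult_distrib)
  qed (use m in measurable)
  then show ?thesis using m by (auto simp: square_integrable_iff)
qed

lemma square_integrable_bounded:
  assumes "f \<in> borel_measurable borel" "\<And>x. cmod (f x) \<le> C"
  shows "square_integrable M f"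
  using square_integrable_mult[of "\<lambda>x. 1" f C] assms by (simp add: square_integrable_iff)

lemma square_integrable_scale:
  "square_integrable M f \<Longrightarrow> square_integrable M (\<lambda>x. c * f x)"
  using square_integrable_mult[of f "\<lambda>x. c" "cmod c"] by simp

lemma square_integrable_diff:
  assumes "square_integrable M f" "square_integrable M g"
  shows "square_integrable M (\<lambda>x. f x - g x)"
  using square_integrable_add[OF assms(1) square_integrable_scale[OF assms(2), of "- 1"]] by simp

lemma square_integrable_trig_polys: "p \<in> trig_polys \<Longrightarrow> square_integrable M p"
  using trig_polys_bounded trig_polys_measurable square_integrable_bounded by blast

lemma LINT_norm_add_sq_le:
  assumes "square_integrable M f" "square_integrable M g"
  shows "(LINT x|M. (cmod (f x + g x))\<^sup>2)
    \<le> 2 * (LINT x|M. (cmod (f x))\<^sup>2) + 2 * (LINT x|M. (cmod (g x))\<^sup>2)"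
proof -
  have "(LINT x|M. (cmod (f x + g x))\<^sup>2) \<le> (LINT x|M. 2 * (cmod (f x))\<^sup>2 + 2 * (cmod (g x))\<^sup>2)"
    using assms square_integrable_add[OF assms]
    by (intro integral_mono norm_add_sq_le) (auto simp: square_integrable_iff)
  also have "\<dots> = 2 * (LINT x|M. (cmod (f x))\<^sup>2) + 2 * (LINT x|M. (cmod (g x))\<^sup>2)"
    using assms by (auto simp: square_integrable_iff)
  finally show ?thesis .
qed

lemma LINT_norm_mult_sq_le:
  assumes "square_integrable M f" "g \<in> borel_measurable borel" "\<And>x. cmod (g x) \<le> C"
  shows "(LINT x|M. (cmod (g x * f x))\<^sup>2) \<le> C\<^sup>2 * (LINT x|M. (cmod (f x))\<^sup>2)"
proof -
  have "(LINT x|M. (cmod (g x * f x))\<^sup>2) \<le> (LINT x|M. C\<^sup>2 * (cmod (f x))\<^sup>2)"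
    using assms square_integrable_mult[OF assms]
    by (intro integral_mono)
      (auto simp: square_integrable_iff norm_mult power_mult_distrib intro!: mult_right_mono power_mono)
  then show ?thesis by simp
qed

lemma l2_closure_superset: "g \<in> S \<Longrightarrow> square_integrable M g \<Longrightarrow> g \<in> l2_closure M S"
  by (auto simp: l2_closure_def intro!: bexI[of _ g])

lemma l2_closureE:
  assumes "f \<in> l2_closure M S" "\<epsilon> > 0"
  obtains g where "g \<in> S" "square_integrable M g" "(LINT x|M. (cmod (f x - g x))\<^sup>2) < \<epsilon>"
  using assms by (auto simp: l2_closure_def)

text \<open>The closure is idempotent. Each of the two approximations gets a quarter of
  \<open>\<epsilon>\<close>, because passing through an intermediate function doubles squared
  errors.\<close>

lemma l2_closure_closed:
  assumes "square_integrable M f"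
    and "\<And>\<epsilon>. \<epsilon> > 0 \<Longrightarrow> \<exists>g\<in>l2_closure M S. (LINT x|M. (cmod (f x - g x))\<^sup>2) < \<epsilon>"
  shows "f \<in> l2_closure M S"
  unfolding l2_closure_def
proof (intro CollectI conjI allI impI assms(1))
  fix \<epsilon> :: real assume "\<epsilon> > 0"
  then have e: "\<epsilon> / 4 > 0" by simp
  from assms(2)[OF e] obtain g where g: "g \<in> l2_closure M S" "(LINT x|M. (cmod (f x - g x))\<^sup>2) < \<epsilon> / 4"
    by auto
  with e obtain h where h: "h \<in> S" "square_integrable M h" "(LINT x|M. (cmod (g x - h x))\<^sup>2) < \<epsilon> / 4"
    using l2_closureE by metis
  have "(LINT x|M. (cmod ((f x - g x) + (g x - h x)))\<^sup>2) < \<epsilon>"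
    using LINT_norm_add_sq_le[of "\<lambda>x. f x - g x" "\<lambda>x. g x - h x"] g h assms(1)
    by (auto simp: l2_closure_def square_integrable_diff)
  then show "\<exists>g\<in>S. square_integrable M g \<and> (LINT x|M. (cmod (f x - g x))\<^sup>2) < \<epsilon>"
    using h by auto
qed

lemma l2_closure_trans:
  assumes "f \<in> l2_closure M S" "S \<subseteq> l2_closure M T"
  shows "f \<in> l2_closure M T"
proof (rule l2_closure_closed)
  show "square_integrable M f" using assms by (simp add: l2_closure_def)
  show "\<exists>g\<in>l2_closure M T. (LINT x|M. (cmod (f x - g x))\<^sup>2) < \<epsilon>" if "\<epsilon> > 0" for \<epsilon>
    using assms that by (force simp: l2_closure_def[of M S])
qed

lemma l2_closure_add:
  assumes S: "\<And>f g. f \<in> S \<Longrightarrow> g \<in> S \<Longrightarrow> (\<lambda>x. f x + g x) \<in> S"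
    and fg: "f \<in> l2_closure M S" "g \<in> l2_closure M S"
  shows "(\<lambda>x. f x + g x) \<in> l2_closure M S"
  unfolding l2_closure_def
proof (intro CollectI conjI allI impI)
  show "square_integrable M (\<lambda>x. f x + g x)"
    using fg by (simp add: l2_closure_def square_integrable_add)
  fix \<epsilon> :: real assume "\<epsilon> > 0"
  then have e: "\<epsilon> / 4 > 0" by simp
  obtain f' where f': "f' \<in> S" "square_integrable M f'" "(LINT x|M. (cmod (f x - f' x))\<^sup>2) < \<epsilon> / 4"
    using l2_closureE[OF fg(1) e] .
  obtain g' where g': "g' \<in> S" "square_integrable M g'" "(LINT x|M. (cmod (g x - g' x))\<^sup>2) < \<epsilon> / 4"
    using l2_closureE[OF fg(2) e] .
  have "(LINT x|M. (cmod ((f x - f' x) + (g x - g' x)))\<^sup>2) < \<epsilon>"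
    using LINT_norm_add_sq_le[of "\<lambda>x. f x - f' x" "\<lambda>x. g x - g' x"] f' g' fg
    by (auto simp: l2_closure_def square_integrable_diff)
  then show "\<exists>h\<in>S. square_integrable M h \<and> (LINT x|M. (cmod (f x + g x - h x))\<^sup>2) < \<epsilon>"
    using f' g' S by (intro bexI[of _ "\<lambda>x. f' x + g' x"]) (auto simp: square_integrable_add algebra_simps)
qed

lemma l2_closure_scale:
  assumes S: "\<And>f. f \<in> S \<Longrightarrow> (\<lambda>x. c * f x) \<in> S"
    and f: "f \<in> l2_closure M S"
  shows "(\<lambda>x. c * f x) \<in> l2_closure M S"
  unfolding l2_closure_def
proof (intro CollectI conjI allI impI)
  show "square_integrable M (\<lambda>x. c * f x)"
    using f by (simp add: l2_closure_def square_integrable_scale)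
  fix \<epsilon> :: real assume e: "\<epsilon> > 0"
  have e': "\<epsilon> / ((cmod c)\<^sup>2 + 1) > 0" using e by (simp add: add_nonneg_pos)
  obtain f' where f': "f' \<in> S" "square_integrable M f'"
      "(LINT x|M. (cmod (f x - f' x))\<^sup>2) < \<epsilon> / ((cmod c)\<^sup>2 + 1)"
    using l2_closureE[OF f e'] .
  have "(LINT x|M. (cmod (c * f x - c * f' x))\<^sup>2) = (cmod c)\<^sup>2 * (LINT x|M. (cmod (f x - f' x))\<^sup>2)"
    by (simp add: right_diff_distrib[symmetric] norm_mult power_mult_distrib)
  also have "\<dots> \<le> ((cmod c)\<^sup>2 + 1) * (LINT x|M. (cmod (f x - f' x))\<^sup>2)"
    by (intro mult_right_mono) auto
  also have "\<dots> < \<epsilon>"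
    using f'(3) by (simp add: pos_less_divide_eq add_nonneg_pos mult.commute)
  finally show "\<exists>g\<in>S. square_integrable M g \<and> (LINT x|M. (cmod (c * f x - g x))\<^sup>2) < \<epsilon>"
    using f' S by (intro bexI[of _ "\<lambda>x. c * f' x"]) (auto simp: square_integrable_scale)
qed

text \<open>Pointwise limits become mean-square limits by dominated convergence: the squared error
  is at most \<open>4 * |w|\<^sup>2\<close>. All later approximations by pointwise limits go through
  this lemma.\<close>

lemma l2_closure_dominated_limit:
  assumes s: "\<And>n. s n \<in> l2_closure M S" and [measurable]: "f \<in> borel_measurable borel"
    and w: "square_integrable M w" and bd: "\<And>n x. cmod (s n x) \<le> cmod (w x)"
    and lim: "\<And>x. (\<lambda>n. s n x) \<longlonglongrightarrow> f x"
  shows "f \<in> l2_closure M S"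
proof -
  have [measurable]: "s n \<in> borel_measurable borel" for n
    using s[of n] by (simp add: l2_closure_def square_integrable_iff)
  have [measurable]: "w \<in> borel_measurable borel"
    using w by (simp add: square_integrable_iff)
  have bf: "cmod (f x) \<le> cmod (w x)" for x
    by (rule LIMSEQ_le_const2[OF tendsto_norm[OF lim]]) (use bd in auto)
  have sq: "square_integrable M f"
    unfolding square_integrable_iff
    by (auto intro!: Bochner_Integration.integrable_bound[of M "\<lambda>x. (cmod (w x))\<^sup>2"] AE_I2 power_mono bf
        w[unfolded square_integrable_iff, THEN conjunct2])
  have "(\<lambda>n. LINT x|M. (cmod (f x - s n x))\<^sup>2) \<longlonglongrightarrow> (LINT x|M. 0)"
  proof (rule integral_dominated_convergence)
    show "integrable M (\<lambda>x. 4 * (cmod (w x))\<^sup>2)" using w by (simp add: square_integrable_iff)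
    show "AE x in M. (\<lambda>n. (cmod (f x - s n x))\<^sup>2) \<longlonglongrightarrow> 0"
      using lim by (intro AE_I2) (auto intro!: tendsto_eq_intros)
    show "AE x in M. norm ((cmod (f x - s n x))\<^sup>2) \<le> 4 * (cmod (w x))\<^sup>2" for n
    proof (intro AE_I2)
      fix x
      have "cmod (f x - s n x) \<le> 2 * cmod (w x)"
        using norm_triangle_ineq4[of "f x" "s n x"] bf[of x] bd[of n x] by linarith
      then have "(cmod (f x - s n x))\<^sup>2 \<le> (2 * cmod (w x))\<^sup>2" by (intro power_mono) auto
      then show "norm ((cmod (f x - s n x))\<^sup>2) \<le> 4 * (cmod (w x))\<^sup>2" by (simp add: power_mult_distrib)
    qed
  qed measurable
  then have "\<exists>n. (LINT x|M. (cmod (f x - s n x))\<^sup>2) < \<epsilon>" if "\<epsilon> > 0" for \<epsilon>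
    using order_tendstoD(2)[of _ 0 sequentially \<epsilon>] that by (auto simp: eventually_sequentially)
  then show ?thesis
    using s by (intro l2_closure_closed sq) blast
qed

text \<open>Approximants of the bounded factor \<open>f\<close> need not be uniformly bounded, so
  the factors are replaced one at a time: first \<open>f\<close> against a fixed trigonometric
  polynomial, whose own bound controls the error, then \<open>g\<close>, where the bound on
  \<open>f\<close> does.\<close>

lemma l2_closure_trig_mult:
  assumes f: "f \<in> l2_closure M trig_polys" "\<And>x. cmod (f x) \<le> C"
    and g: "g \<in> l2_closure M trig_polys"
  shows "(\<lambda>x. f x * g x) \<in> l2_closure M trig_polys"
proof -
  have sf: "square_integrable M f" and sg: "square_integrable M g"
    and [measurable]: "f \<in> borel_measurable borel" "g \<in> borel_measurable borel"
    using f g by (auto simp: l2_closure_def square_integrable_iff)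
  have fp: "(\<lambda>x. f x * p x) \<in> l2_closure M trig_polys" if p: "p \<in> trig_polys" for p
    unfolding l2_closure_def
  proof (intro CollectI conjI allI impI)
    have sp: "square_integrable M p" using p by (rule square_integrable_trig_polys)
    then show "square_integrable M (\<lambda>x. f x * p x)"
      using f(2) by (intro square_integrable_mult) auto
    obtain D where D: "D > 0" "\<And>x. cmod (p x) \<le> D" using trig_polys_bounded[OF p] by blast
    fix \<epsilon> :: real assume "\<epsilon> > 0"
    then have e: "\<epsilon> / D\<^sup>2 > 0" using D by simp
    obtain q where q: "q \<in> trig_polys" "square_integrable M q"
        "(LINT x|M. (cmod (f x - q x))\<^sup>2) < \<epsilon> / D\<^sup>2"
      using l2_closureE[OF f(1) e] .
    have "(LINT x|M. (cmod (p x * (f x - q x)))\<^sup>2) \<le> D\<^sup>2 * (LINT x|M. (cmod (f x - q x))\<^sup>2)"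
      using sf q D p by (intro LINT_norm_mult_sq_le square_integrable_diff trig_polys_measurable)
    also have "\<dots> < \<epsilon>" using q(3) D by (simp add: field_simps)
    finally show "\<exists>h\<in>trig_polys. square_integrable M h \<and> (LINT x|M. (cmod (f x * p x - h x))\<^sup>2) < \<epsilon>"
      using q p
      by (intro bexI[of _ "\<lambda>x. q x * p x"])
        (auto simp: trig_polys_mult square_integrable_trig_polys algebra_simps)
  qed
  have C: "0 \<le> C" using f(2)[of 0] norm_ge_zero order_trans by blast
  show ?thesis
  proof (rule l2_closure_closed)
    show "square_integrable M (\<lambda>x. f x * g x)"
      using sg f(2) by (intro square_integrable_mult) auto
    fix \<epsilon> :: real assume "\<epsilon> > 0"
    then have e: "\<epsilon> / (C\<^sup>2 + 1) > 0" using C by (simp add: add_nonneg_pos)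
    obtain p where p: "p \<in> trig_polys" "square_integrable M p"
        "(LINT x|M. (cmod (g x - p x))\<^sup>2) < \<epsilon> / (C\<^sup>2 + 1)"
      using l2_closureE[OF g e] .
    have "(LINT x|M. (cmod (f x * (g x - p x)))\<^sup>2) \<le> C\<^sup>2 * (LINT x|M. (cmod (g x - p x))\<^sup>2)"
      using sg p f(2) by (intro LINT_norm_mult_sq_le square_integrable_diff) auto
    also have "\<dots> \<le> (C\<^sup>2 + 1) * (LINT x|M. (cmod (g x - p x))\<^sup>2)"
      by (intro mult_right_mono) auto
    also have "\<dots> < \<epsilon>" using p(3) by (simp add: pos_less_divide_eq add_nonneg_pos mult.commute)
    finally show "\<exists>h\<in>l2_closure M trig_polys. (LINT x|M. (cmod (f x * g x - h x))\<^sup>2) < \<epsilon>"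
      using fp[OF p(1)] by (intro bexI[of _ "\<lambda>x. f x * p x"]) (auto simp: algebra_simps)
  qed
qed

lemma l2_closure_trig_one: "(\<lambda>x. 1) \<in> l2_closure M trig_polys"
  by (intro l2_closure_superset one_in_trig_polys square_integrable_trig_polys)

lemma l2_closure_trig_add:
  assumes "f \<in> l2_closure M trig_polys" "g \<in> l2_closure M trig_polys"
  shows "(\<lambda>x. f x + g x) \<in> l2_closure M trig_polys"
  using trig_polys.add assms by (rule l2_closure_add)

lemma l2_closure_trig_scale:
  assumes "f \<in> l2_closure M trig_polys"
  shows "(\<lambda>x. c * f x) \<in> l2_closure M trig_polys"
  using trig_polys.scale assms by (rule l2_closure_scale)

lemma l2_closure_trig_zero: "(\<lambda>x. 0) \<in> l2_closure M trig_polys"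
  using l2_closure_trig_scale[OF l2_closure_trig_one, of 0] by simp

lemma l2_closure_trig_compl:
  assumes "f \<in> l2_closure M trig_polys"
  shows "(\<lambda>x. 1 - f x) \<in> l2_closure M trig_polys"
  using l2_closure_trig_add[OF l2_closure_trig_one
      l2_closure_trig_scale[OF assms, of "- 1"]]
  by simp

lemma l2_closure_trig_power:
  assumes f: "f \<in> l2_closure M trig_polys" "\<And>x. cmod (f x) \<le> 1"
  shows "(\<lambda>x. f x ^ n) \<in> l2_closure M trig_polys"
proof (induction n)
  case 0
  then show ?case using l2_closure_trig_one by simp
next
  case (Suc n)
  then show ?case using l2_closure_trig_mult[OF f Suc] by simp
qed

end

section \<open>Indicators as limits, and density of trigonometric polynomials\<close>

text \<open>With \<open>u\<close> a rescaled sine this makes indicator functions of half-lines limits of trigonometric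
  polynomials. The exponent \<open>n * 2 ^ n\<close> instead of \<open>2 ^ n\<close> forces the limit 0 also at \<open>u = 1 / 2\<close>.\<close>

lemma half_threshold_limit:
  fixes u :: real
  assumes "0 \<le> u" "u \<le> 1"
  shows "(\<lambda>n. (1 - u ^ n) ^ (n * 2 ^ n)) \<longlonglongrightarrow> (if u < 1 / 2 then 1 else 0)"
proof (cases "u < 1 / 2")
  case True
  have un: "u ^ n \<le> 1" for n using assms by (simp add: power_le_one)
  have lo: "1 - real n * (2 * u) ^ n \<le> (1 - u ^ n) ^ (n * 2 ^ n)" for n
    using Bernoulli_inequality[of "- (u ^ n)" "n * 2 ^ n"] un[of n]
    by (simp add: power_mult_distrib mult_ac)
  have hi: "(1 - u ^ n) ^ (n * 2 ^ n) \<le> 1" for n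
    using un[of n] assms by (intro power_le_one) auto
  have "(\<lambda>n. real n * (2 * u) ^ n) \<longlonglongrightarrow> 0"
    using powser_times_n_limit_0[of "2 * u"] True assms by simp
  then have "(\<lambda>n. 1 - real n * (2 * u) ^ n) \<longlonglongrightarrow> 1 - 0"
    by (intro tendsto_intros)
  then have "(\<lambda>n. (1 - u ^ n) ^ (n * 2 ^ n)) \<longlonglongrightarrow> 1"
    by (intro tendsto_sandwich[OF always_eventually[OF allI[OF lo]] always_eventually[OF allI[OF hi]]])
      auto
  then show ?thesis using True by simp
next
  case False
  have hi: "(1 - u ^ n) ^ (n * 2 ^ n) \<le> exp (- real n)" for n
  proof -
    have un: "u ^ n \<le> 1" "(1 / 2) ^ n \<le> u ^ n"
      using assms False by (auto simp: power_le_one intro!: power_mono)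
    \<comment> \<open>Here
      \<open>1 - u ^ n \<le> 1 - (1 / 2) ^ n \<le> exp (- ((1 / 2) ^ n))\<close>; the factor
      \<open>2 ^ n\<close> of the exponent then cancels and leaves \<open>exp (- n)\<close>.\<close>
    have "(1 - u ^ n) ^ (n * 2 ^ n) \<le> exp (- ((1 / 2) ^ n)) ^ (n * 2 ^ n)"
      using un exp_ge_add_one_self[of "- ((1 / 2 :: real) ^ n)"] by (intro power_mono) auto
    also have "\<dots> = exp (- real n)"
      by (simp add: exp_of_nat_mult[symmetric] power_divide)
    finally show ?thesis .
  qed
  have lo: "0 \<le> (1 - u ^ n) ^ (n * 2 ^ n)" for n
    using assms by (auto simp: power_le_one)
  have "(\<lambda>n. exp (- real n)) \<longlonglongrightarrow> 0"
    by real_asymp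
  then have "(\<lambda>n. (1 - u ^ n) ^ (n * 2 ^ n)) \<longlonglongrightarrow> 0"
    by (intro tendsto_sandwich[OF always_eventually[OF allI[OF lo]] always_eventually[OF allI[OF hi]]])
      auto
  then show ?thesis using False by simp
qed

text \<open>Once \<open>n\<close> exceeds \<open>|y|\<close>, the argument lies strictly between -1
  and 1, where the sine has the sign of its argument.\<close>

lemma sin_threshold_limit:
  fixes y :: real
  shows "(\<lambda>n. if sin (y / real (Suc n)) < 0 then 1 else 0 :: complex) \<longlonglongrightarrow> (if y < 0 then 1 else 0)"
proof -
  obtain m :: nat where m: "\<bar>y\<bar> < real m" using reals_Archimedean2 by blast
  have "(sin (y / real (Suc n)) < 0) = (y < 0)" if "n \<ge> m" for n
  proof -
    have "\<bar>y\<bar> < real (Suc n)" using m that by linarith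
    then have z: "\<bar>y / real (Suc n)\<bar> < 1" by simp
    show ?thesis
    proof (cases "y < 0")
      case True
      then have "0 < - (y / real (Suc n))" "- (y / real (Suc n)) < pi"
        using z pi_gt3 by (auto simp: divide_neg_pos abs_less_iff)
      from sin_gt_zero[OF this] True show ?thesis by simp
    next
      case False
      then have "0 \<le> y / real (Suc n)" by simp
      moreover from this have "y / real (Suc n) \<le> pi"
        using z pi_gt3 by linarith
      ultimately have "0 \<le> sin (y / real (Suc n))" by (rule sin_ge_zero)
      with False show ?thesis by simp
    qed
  qed
  then show ?thesis
    by (intro tendsto_eventually) (auto simp: eventually_sequentially)
qed

context real_distribution
begin

text \<open>Two limits are taken. Thresholding a sine gives a periodic step function that changes
  value at \<open>a\<close>; letting its period tend to infinity leaves only the jump at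
  \<open>a\<close>.\<close>

lemma indicator_lessThan_in_l2_closure:
  "(indicator {..<a} :: real \<Rightarrow> complex) \<in> l2_closure M trig_polys"
proof -
  have step: "(\<lambda>x. if sin ((x - a) / real (Suc m)) < 0 then 1 else 0) \<in> l2_closure M trig_polys" for m
  proof -
    \<comment> \<open>The sine is moved into the unit interval, so that its sign becomes the
      threshold \<open>1 / 2\<close>.\<close>
    define u where "u x = (1 + sin ((x - a) / real (Suc m))) / 2" for x
    have "0 \<le> (1 + v) / 2 \<and> (1 + v) / 2 \<le> 1" if "- 1 \<le> v" "v \<le> 1" for v :: real
      using that by auto
    then have u01: "0 \<le> u x" "u x \<le> 1" for x
      by (simp_all only: u_def sin_ge_minus_one sin_le_one)
    have "(\<lambda>x. complex_of_real (u x)) \<in> trig_polys"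
    proof -
      have "(\<lambda>x. 1 / 2 * (1 + complex_of_real (sin (1 / real (Suc m) * x + - a / real (Suc m)))))
          \<in> trig_polys"
        by (intro trig_polys.scale trig_polys.add one_in_trig_polys sin_in_trig_polys)
      then show ?thesis by (simp add: u_def diff_divide_distrib)
    qed
    then have uW: "(\<lambda>x. complex_of_real (u x)) \<in> l2_closure M trig_polys"
      by (intro l2_closure_superset square_integrable_trig_polys)
    have un: "0 \<le> u x ^ n" "u x ^ n \<le> 1" for x n using u01 by (auto simp: power_le_one)
    have W: "(\<lambda>x. complex_of_real ((1 - u x ^ n) ^ (n * 2 ^ n))) \<in> l2_closure M trig_polys" for n
    proof -
      have "(\<lambda>x. (1 - complex_of_real (u x) ^ n) ^ (n * 2 ^ n)) \<in> l2_closure M trig_polys"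
      proof (intro l2_closure_trig_power l2_closure_trig_compl uW)
        show "cmod (complex_of_real (u x)) \<le> 1" for x using u01[of x] by simp
        show "cmod (1 - complex_of_real (u x) ^ n) \<le> 1" for x
        proof -
          have "1 - complex_of_real (u x) ^ n = complex_of_real (1 - u x ^ n)" by simp
          then show ?thesis using un[of x n] by (simp only: norm_of_real)
        qed
      qed
      then show ?thesis by simp
    qed
    show ?thesis
    proof (rule l2_closure_dominated_limit[OF W, where w = "\<lambda>_. 1"])
      show "square_integrable M (\<lambda>_. 1)" by (rule square_integrable_bounded[of _ 1]) auto
      show "cmod (complex_of_real ((1 - u x ^ n) ^ (n * 2 ^ n))) \<le> cmod 1" for n x
      proof -
        have "0 \<le> (1 - u x ^ n) ^ (n * 2 ^ n)" "(1 - u x ^ n) ^ (n * 2 ^ n) \<le> 1"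
          using un[of x n] by (intro zero_le_power power_le_one; simp)+
        then show ?thesis by (simp only: norm_of_real norm_one abs_of_nonneg)
      qed
      have "(\<lambda>n. complex_of_real ((1 - u x ^ n) ^ (n * 2 ^ n)))
          \<longlonglongrightarrow> complex_of_real (if u x < 1 / 2 then 1 else 0)" for x
        by (intro tendsto_of_real half_threshold_limit u01)
      moreover have "u x < 1 / 2 \<longleftrightarrow> sin ((x - a) / real (Suc m)) < 0" for x
        by (simp add: u_def field_simps)
      ultimately show "(\<lambda>n. complex_of_real ((1 - u x ^ n) ^ (n * 2 ^ n)))
          \<longlonglongrightarrow> (if sin ((x - a) / real (Suc m)) < 0 then 1 else 0)" for x
        by (simp only: if_distrib[of complex_of_real] of_real_0 of_real_1 cong: if_cong)
    qed measurable
  qed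
  show ?thesis
  proof (rule l2_closure_dominated_limit[OF step, where w = "\<lambda>_. 1"])
    show "square_integrable M (\<lambda>_. 1)" by (rule square_integrable_bounded[of _ 1]) auto
    show "(\<lambda>n. if sin ((x - a) / real (Suc n)) < 0 then 1 else 0) \<longlonglongrightarrow> (indicator {..<a} x :: complex)" for x
    proof -
      have "(if x - a < 0 then 1 else 0) = (indicator {..<a} x :: complex)"
        by (simp add: indicator_def)
      with sin_threshold_limit[of "x - a"] show ?thesis by (simp only:)
    qed
  qed auto
qed

text \<open>Half-lines generate the Borel sets and are stable under intersection, so Dynkin's
  theorem applies. In the union case disjointness keeps the partial sums of indicators bounded by 1,
  as dominated convergence requires.\<close>

lemma indicator_in_l2_closure:
  assumes "A \<in> sets borel"
  shows "(indicator A :: real \<Rightarrow> complex) \<in> l2_closure M trig_polys"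
proof -
  have borel: "sets (borel :: real measure) = sigma_sets UNIV (range lessThan)"
    by (simp add: borel_eq_lessThan eucl_lessThan lessThan_def)
  then have A: "A \<in> sigma_sets UNIV (range lessThan)" using assms by simp
  have 1: "Int_stable (range (lessThan :: real \<Rightarrow> _))"
    by (auto simp: Int_stable_def greaterThan_Int_greaterThan)
  have 2: "range (lessThan :: real \<Rightarrow> _) \<subseteq> Pow UNIV"
    by simp
  from 1 2 A show ?thesis
  proof (induction A rule: sigma_sets_induct_disjoint)
    case (basic A)
    then show ?case using indicator_lessThan_in_l2_closure by auto
  next
    case empty
    then show ?case
      using l2_closure_trig_zero by (simp add: indicator_def)
  next
    case (compl A)
    have "indicator (UNIV - A) = (\<lambda>x. 1 - indicator A x :: complex)"
      by (auto simp: indicator_def)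
    then show ?case using l2_closure_trig_compl[OF compl(2)] by (simp only:)
  next
    case (union A)
    have m: "A i \<in> sets borel" for i
      using union(2) unfolding borel image_subset_iff by (rule bspec) (rule UNIV_I)
    have s: "(\<lambda>x. \<Sum>i<n. indicator (A i) x :: complex) \<in> l2_closure M trig_polys" for n
    proof (induction n)
      case 0
      then show ?case
        using l2_closure_trig_zero by simp
    next
      case (Suc n)
      have "(\<lambda>x. (\<Sum>i<n. indicator (A i) x) + indicator (A n) x :: complex) \<in> l2_closure M trig_polys"
        using Suc union(3) by (rule l2_closure_trig_add)
      then show ?case by (simp only: sum.lessThan_Suc)
    qed
    have dj: "disjoint_family_on A {..<n}" for n
      using union(1) by (rule disjoint_family_on_mono[OF subset_UNIV])
    have eq: "(\<Sum>i<n. indicator (A i) x :: complex) = indicator (\<Union>i<n. A i) x" for n x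
      by (rule indicator_UN_disjoint[OF finite_lessThan dj, symmetric])
    show ?case
    proof (rule l2_closure_dominated_limit[OF s, where w = "\<lambda>_. 1"])
      show "square_integrable M (\<lambda>_. 1)" by (rule square_integrable_bounded[of _ 1]) auto
      show "(\<lambda>n. \<Sum>i<n. indicator (A i) x :: complex) \<longlonglongrightarrow> indicator (\<Union> (range A)) x" for x
        unfolding eq by (rule LIMSEQ_indicator_UN)
      show "cmod (\<Sum>i<n. indicator (A i) x :: complex) \<le> cmod 1" for n x
        unfolding eq by (simp add: indicator_def)
      show "(indicator (\<Union> (range A)) :: real \<Rightarrow> complex) \<in> borel_measurable borel"
        using m by (intro borel_measurable_indicator sets.countable_UN) auto
    qed
  qed
qed

text \<open>A measurable function is a pointwise limit of simple functions dominated by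
  \<open>2 * |f|\<close>, and simple functions are finite combinations of indicators of Borel
  sets.\<close>

lemma trig_polys_dense:
  assumes f: "square_integrable M f"
  shows "f \<in> l2_closure M trig_polys"
proof -
  have [measurable]: "f \<in> borel_measurable borel" using f by (simp add: square_integrable_iff)
  obtain s where s: "\<And>i. simple_function borel (s i)" "\<And>x. (\<lambda>i. s i x) \<longlonglongrightarrow> f x"
      "\<And>i x. cmod (s i x) \<le> 2 * cmod (f x)"
  proof -
    have "\<exists>s. (\<forall>i. simple_function borel (s i)) \<and> (\<forall>x\<in>space borel. (\<lambda>i. s i x) \<longlonglongrightarrow> f x) \<and>
        (\<forall>i. \<forall>x\<in>space borel. dist (s i x) 0 \<le> 2 * dist (f x) 0)"
      by (rule borel_measurable_implies_sequence_metric) measurable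
    then obtain s where s: "\<forall>i. simple_function borel (s i)"
        "\<forall>x\<in>space borel. (\<lambda>i. s i x) \<longlonglongrightarrow> f x"
        "\<forall>i. \<forall>x\<in>space borel. dist (s i x) 0 \<le> 2 * dist (f x) 0"
      by (elim exE conjE)
    show ?thesis
      by (rule that[of s]) (use s in simp_all)
  qed
  have "s i \<in> l2_closure M trig_polys" for i
  proof -
    have fin: "finite (range (s i))" using simple_functionD(1)[OF s(1)[of i]] by simp
    have eq: "s i = (\<lambda>x. \<Sum>y\<in>range (s i). y * indicator (s i -` {y}) x)"
    proof
      fix x
      have "(\<Sum>y\<in>range (s i). y * indicator (s i -` {y}) x)
          = (\<Sum>y\<in>range (s i). if s i x = y then y else 0)"
        by (intro sum.cong) (auto simp: indicator_def)
      also have "\<dots> = s i x" using fin by simp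
      finally show "s i x = (\<Sum>y\<in>range (s i). y * indicator (s i -` {y}) x)" ..
    qed
    have "(\<lambda>x. \<Sum>y\<in>Y. y * indicator (s i -` {y}) x) \<in> l2_closure M trig_polys" if "finite Y" for Y
      using that
    proof induction
      case empty
      then show ?case
        using l2_closure_trig_zero by simp
    next
      case (insert y Y)
      have "s i -` {y} \<in> sets borel" using simple_functionD(2)[OF s(1)[of i], of "{y}"] by simp
      from l2_closure_trig_scale[OF indicator_in_l2_closure[OF this]]
      have "(\<lambda>x. y * indicator (s i -` {y}) x) \<in> l2_closure M trig_polys" .
      from l2_closure_trig_add[OF this insert.IH]
      have "(\<lambda>x. y * indicator (s i -` {y}) x + (\<Sum>z\<in>Y. z * indicator (s i -` {z}) x))
          \<in> l2_closure M trig_polys" .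
      then show ?case
        by (simp only: sum.insert[OF insert.hyps])
    qed
    from this[OF fin] show ?thesis
      by (rule ssubst[OF eq, where P = "\<lambda>h. h \<in> l2_closure M trig_polys"])
  qed
  then show ?thesis
  proof (rule l2_closure_dominated_limit)
    show "square_integrable M (\<lambda>x. 2 * f x)" using f by (rule square_integrable_scale)
    show "cmod (s n x) \<le> cmod (2 * f x)" for n x using s(3)[of n x] by (simp add: norm_mult)
    show "(\<lambda>n. s n x) \<longlonglongrightarrow> f x" for x by (rule s(2))
  qed measurable
qed

end

section \<open>A criterion for orthonormal bases of exponentials\<close>

definition exp_span :: "real set \<Rightarrow> (real \<Rightarrow> complex) set" where
  "exp_span \<Lambda> = {\<lambda>x. \<Sum>s\<in>F. c s * expo s x | F c. finite F \<and> F \<subseteq> \<Lambda>}"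

lemma exp_spanE:
  assumes "f \<in> exp_span \<Lambda>"
  obtains F c where "f = (\<lambda>x. \<Sum>s\<in>F. c s * expo s x)" "finite F" "F \<subseteq> \<Lambda>"
  using assms unfolding exp_span_def by blast

lemma exp_spanI:
  "finite F \<Longrightarrow> F \<subseteq> \<Lambda> \<Longrightarrow> (\<lambda>x. \<Sum>s\<in>F. c s * expo s x) \<in> exp_span \<Lambda>"
  unfolding exp_span_def by blast

lemma exp_span_add:
  assumes "f \<in> exp_span \<Lambda>" "g \<in> exp_span \<Lambda>"
  shows "(\<lambda>x. f x + g x) \<in> exp_span \<Lambda>"
proof -
  obtain F c where F: "f = (\<lambda>x. \<Sum>s\<in>F. c s * expo s x)" "finite F" "F \<subseteq> \<Lambda>"
    using assms(1) by (rule exp_spanE)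
  obtain G d where G: "g = (\<lambda>x. \<Sum>s\<in>G. d s * expo s x)" "finite G" "G \<subseteq> \<Lambda>"
    using assms(2) by (rule exp_spanE)
  \<comment> \<open>A frequency may occur in both sums, so the coefficients are extended by zero and
    added over the union.\<close>
  define e where "e s = (if s \<in> F then c s else 0) + (if s \<in> G then d s else 0)" for s
  have "f x + g x = (\<Sum>s\<in>F \<union> G. e s * expo s x)" for x
  proof -
    have "f x = (\<Sum>s\<in>F \<union> G. (if s \<in> F then c s else 0) * expo s x)"
      using F G by (auto intro!: sum.mono_neutral_cong_left)
    moreover have "g x = (\<Sum>s\<in>F \<union> G. (if s \<in> G then d s else 0) * expo s x)"
      using F G by (auto intro!: sum.mono_neutral_cong_left)
    ultimately show ?thesis by (simp add: e_def sum.distrib[symmetric] distrib_right)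
  qed
  then show ?thesis
    using F G unfolding exp_span_def by (auto intro!: exI[of _ "F \<union> G"] exI[of _ e])
qed

lemma exp_span_scale:
  assumes "f \<in> exp_span \<Lambda>"
  shows "(\<lambda>x. a * f x) \<in> exp_span \<Lambda>"
proof -
  obtain F c where F: "f = (\<lambda>x. \<Sum>s\<in>F. c s * expo s x)" "finite F" "F \<subseteq> \<Lambda>"
    using assms by (rule exp_spanE)
  then have "(\<lambda>x. a * f x) = (\<lambda>x. \<Sum>s\<in>F. (a * c s) * expo s x)"
    by (simp add: sum_distrib_left mult_ac)
  then show ?thesis
    unfolding exp_span_def mem_Collect_eq
    using F by (intro exI[of _ F] exI[of _ "\<lambda>s. a * c s"]) simp
qed

context real_distribution
begin

lemma square_integrable_expo: "square_integrable M (expo t)"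
  by (rule square_integrable_trig_polys) (rule trig_polys.expo)

lemma integrable_expo [simp]: "integrable M (expo t)"
  by (rule integrable_const_bound[of _ 1])
    (auto simp: measurable_cong_sets[OF events_eq_borel refl])

lemma LINT_expo: "(LINT x|M. expo t x) = char M (- 2 * pi * t)"
  unfolding char_def by (simp add: expo_def mult_ac)

lemma char_uminus: "char M (- t) = cnj (char M t)"
proof -
  have "cnj (char M t) = (CLINT x|M. cnj (iexp (t * x)))"
    unfolding char_def by (rule Bochner_Integration.integral_cnj[symmetric])
  then show ?thesis by (simp add: char_def exp_cnj)
qed

lemma l2_inner_expo: "l2_inner M (expo s) (expo t) = char M (2 * pi * (t - s))"
proof -
  have "l2_inner M (expo s) (expo t) = (LINT x|M. expo (s - t) x)"
    by (simp add: l2_inner_def cnj_expo expo_mult)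
  then show ?thesis by (simp add: LINT_expo algebra_simps)
qed

text \<open>The number \<open>c s\<close> is the Fourier coefficient of \<open>expo t\<close> with
  respect to \<open>expo s\<close>, so this is Pythagoras for the orthogonal projection onto the
  span of a finite orthonormal family.\<close>

lemma bessel_identity:
  fixes t :: real
  assumes F: "finite F" and orth: "\<And>s t. s \<in> F \<Longrightarrow> t \<in> F \<Longrightarrow> s \<noteq> t \<Longrightarrow> char M (2 * pi * (s - t)) = 0"
  defines "c \<equiv> \<lambda>s. char M (2 * pi * (s - t))"
  shows "(LINT x|M. (cmod (expo t x - (\<Sum>s\<in>F. c s * expo s x)))\<^sup>2) = 1 - (\<Sum>s\<in>F. (cmod (c s))\<^sup>2)"
proof -
  have ex: "(LINT x|M. expo (s - t') x) = char M (2 * pi * (t' - s))" for s t'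
    by (simp add: LINT_expo algebra_simps)
  have cc: "char M (2 * pi * (t - s)) = cnj (c s)" for s
    using char_uminus[of "2 * pi * (s - t)"] by (simp add: c_def algebra_simps)
  have pointwise: "complex_of_real ((cmod (expo t x - (\<Sum>s\<in>F. c s * expo s x)))\<^sup>2) =
      1 - (\<Sum>s\<in>F. cnj (c s) * expo (t - s) x) - (\<Sum>s\<in>F. c s * expo (s - t) x)
        + (\<Sum>s\<in>F. \<Sum>r\<in>F. c s * cnj (c r) * expo (s - r) x)" for x
  proof -
    have "complex_of_real ((cmod (expo t x - (\<Sum>s\<in>F. c s * expo s x)))\<^sup>2) =
      (expo t x - (\<Sum>s\<in>F. c s * expo s x)) * (expo (- t) x - (\<Sum>s\<in>F. cnj (c s) * expo (- s) x))"
      by (subst complex_norm_square) (simp add: cnj_expo)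
    also have "\<dots> = expo t x * expo (- t) x - (\<Sum>s\<in>F. cnj (c s) * (expo t x * expo (- s) x))
        - (\<Sum>s\<in>F. c s * (expo s x * expo (- t) x))
        + (\<Sum>s\<in>F. \<Sum>r\<in>F. c s * cnj (c r) * (expo s x * expo (- r) x))"
    proof -
      have eq: "(p - q) * (p' - q') = p * p' - p * q' - q * p' + q * q'" for p q p' q' :: complex
        by (simp add: algebra_simps)
      show ?thesis
        by (simp only: eq sum_product) (simp add: sum_distrib_left sum_distrib_right mult_ac)
    qed
    finally show ?thesis by (simp add: expo_mult)
  qed
  have "complex_of_real (LINT x|M. (cmod (expo t x - (\<Sum>s\<in>F. c s * expo s x)))\<^sup>2) =
      (LINT x|M. 1 - (\<Sum>s\<in>F. cnj (c s) * expo (t - s) x) - (\<Sum>s\<in>F. c s * expo (s - t) x)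
        + (\<Sum>s\<in>F. \<Sum>r\<in>F. c s * cnj (c r) * expo (s - r) x))"
    by (simp only: integral_complex_of_real[symmetric] pointwise)
  also have "\<dots> = 1 - (\<Sum>s\<in>F. cnj (c s) * c s) - (\<Sum>s\<in>F. c s * cnj (c s))
        + (\<Sum>s\<in>F. \<Sum>r\<in>F. c s * cnj (c r) * char M (2 * pi * (r - s)))"
    by (simp add: ex cc prob_space[unfolded space_eq_univ]) (simp add: c_def)
  \<comment> \<open>Orthogonality leaves only the diagonal of the double sum, which cancels one of
    the two mixed terms.\<close>
  also have "(\<Sum>s\<in>F. \<Sum>r\<in>F. c s * cnj (c r) * char M (2 * pi * (r - s))) = (\<Sum>s\<in>F. c s * cnj (c s))"
  proof (rule sum.cong[OF refl])
    fix s assume s: "s \<in> F"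
    have "(\<Sum>r\<in>F. c s * cnj (c r) * char M (2 * pi * (r - s))) =
        (\<Sum>r\<in>F. if r = s then c s * cnj (c s) else 0)"
      using orth s by (intro sum.cong) (auto simp: char_zero)
    then show "(\<Sum>r\<in>F. c s * cnj (c r) * char M (2 * pi * (r - s))) = c s * cnj (c s)"
      using F s by simp
  qed
  also have "1 - (\<Sum>s\<in>F. cnj (c s) * c s) - (\<Sum>s\<in>F. c s * cnj (c s)) + (\<Sum>s\<in>F. c s * cnj (c s))
      = complex_of_real (1 - (\<Sum>s\<in>F. (cmod (c s))\<^sup>2))"
    by (simp add: complex_norm_square[unfolded of_real_power] mult.commute)
  finally show ?thesis by (simp only: of_real_eq_iff)
qed

text \<open>By the Bessel identity, \<open>complete\<close> says that each single exponential is
  approximated by its projections. Exponentials of all real frequencies span a dense set, so the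
  span over \<open>\<Lambda>\<close> is dense as well.\<close>

lemma l2_orthonormal_basis_expo:
  assumes orth: "\<And>s t. s \<in> \<Lambda> \<Longrightarrow> t \<in> \<Lambda> \<Longrightarrow> s \<noteq> t \<Longrightarrow> char M (2 * pi * (s - t)) = 0"
    and complete: "\<And>x \<epsilon>. \<epsilon> > 0 \<Longrightarrow>
      \<exists>F. finite F \<and> F \<subseteq> \<Lambda> \<and> 1 - \<epsilon> < (\<Sum>s\<in>F. (cmod (char M (2 * pi * (s + x))))\<^sup>2)"
  shows "l2_orthonormal_basis M \<Lambda> expo"
proof -
  have span_sq: "square_integrable M g" if g: "g \<in> exp_span \<Lambda>" for g
  proof -
    obtain F c where "g = (\<lambda>x. \<Sum>s\<in>F. c s * expo s x)" "finite F" "F \<subseteq> \<Lambda>"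
      using g by (rule exp_spanE)
    moreover have "square_integrable M (\<lambda>x. \<Sum>s\<in>F. c s * expo s x)" if "finite F"
      using that
    proof induction
      case empty
      then show ?case by (simp add: square_integrable_iff)
    next
      case (insert s F)
      from square_integrable_add[OF square_integrable_scale[OF square_integrable_expo] insert.IH]
      show ?case by (simp only: sum.insert[OF insert.hyps])
    qed
    ultimately show ?thesis by simp
  qed
  have "trig_polys \<subseteq> l2_closure M (exp_span \<Lambda>)"
  proof
    fix p assume "p \<in> trig_polys"
    then show "p \<in> l2_closure M (exp_span \<Lambda>)"
    proof (induction rule: trig_polys.induct)
      case (expo t)
      show ?case
        unfolding l2_closure_def
      proof (intro CollectI conjI allI impI square_integrable_expo)
        fix \<epsilon> :: real assume "\<epsilon> > 0"
        then obtain F where F: "finite F" "F \<subseteq> \<Lambda>"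
            "1 - \<epsilon> < (\<Sum>s\<in>F. (cmod (char M (2 * pi * (s + - t))))\<^sup>2)"
          \<comment> \<open>The translate by \<open>- t\<close> turns the terms of
            \<open>complete\<close> into the squared Fourier coefficients of
            \<open>expo t\<close>.\<close>
          using complete[of \<epsilon> "- t"] by blast
        define g where "g x = (\<Sum>s\<in>F. char M (2 * pi * (s - t)) * expo s x)" for x
        have "g \<in> exp_span \<Lambda>" unfolding g_def using F by (intro exp_spanI)
        moreover have "(LINT x|M. (cmod (expo t x - g x))\<^sup>2) < \<epsilon>"
          unfolding g_def using F(3) by (subst bessel_identity) (use F orth in auto)
        ultimately show "\<exists>g\<in>exp_span \<Lambda>. square_integrable M g \<and>
            (LINT x|M. (cmod (expo t x - g x))\<^sup>2) < \<epsilon>"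
          using span_sq by blast
      qed
    next
      case (scale p c)
      show ?case using exp_span_scale scale.IH by (rule l2_closure_scale)
    next
      case (add p q)
      show ?case using exp_span_add add.IH by (rule l2_closure_add)
    qed
  qed
  then have dense: "f \<in> l2_closure M (exp_span \<Lambda>)" if "square_integrable M f" for f
    using trig_polys_dense[OF that] by (rule l2_closure_trans[rotated])
  show ?thesis
    unfolding l2_orthonormal_basis_def
  proof (intro conjI ballI allI impI)
    fix f and \<epsilon> :: real assume f: "square_integrable M f" and "\<epsilon> > 0"
    then have "\<epsilon>\<^sup>2 > 0" by simp
    from l2_closureE[OF dense[OF f] this] obtain g where
      g: "g \<in> exp_span \<Lambda>" "(LINT x|M. (cmod (f x - g x))\<^sup>2) < \<epsilon>\<^sup>2" .
    from g(1) obtain F c where F: "g = (\<lambda>x. \<Sum>s\<in>F. c s * expo s x)" "finite F" "F \<subseteq> \<Lambda>"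
      by (rule exp_spanE)
    have "l2_norm M (\<lambda>x. f x - (\<Sum>s\<in>F. c s * expo s x)) < \<epsilon>"
      using g(2) \<open>\<epsilon> > 0\<close> unfolding l2_norm_def F(1) by (intro real_less_lsqrt) auto
    then show "\<exists>F c. finite F \<and> F \<subseteq> \<Lambda> \<and> l2_norm M (\<lambda>x. f x - (\<Sum>s\<in>F. c s * expo s x)) < \<epsilon>"
      using F by blast
  next
    fix s t assume "s \<in> \<Lambda>" "t \<in> \<Lambda>"
    then show "l2_inner M (expo s) (expo t) = (if s = t then 1 else 0)"
      using orth[of t s] by (auto simp: l2_inner_expo char_zero)
  qed (rule square_integrable_expo)
qed

end

section \<open>Balanced residues\<close>

text \<open>The representative of \<open>x\<close> modulo \<open>m\<close> in the half-open interval
  from \<open>- m / 2\<close> to \<open>m / 2\<close>. Everything is doubled to stay within the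
  integers: \<open>2 * bal m x + m\<close> is the remainder of \<open>2 * x + m\<close> modulo
  \<open>2 * m\<close>.\<close>

definition bal :: "int \<Rightarrow> int \<Rightarrow> int" where
  "bal m x = x - m * ((2 * x + m) div (2 * m))"

lemma bal_bounds:
  assumes "m > 0"
  shows "- m \<le> 2 * bal m x" "2 * bal m x < m"
proof -
  have "2 * bal m x + m = (2 * x + m) mod (2 * m)"
    unfolding bal_def by (simp add: minus_mult_div_eq_mod[symmetric] algebra_simps)
  moreover have "0 \<le> (2 * x + m) mod (2 * m)" "(2 * x + m) mod (2 * m) < 2 * m"
    using assms by auto
  ultimately show "- m \<le> 2 * bal m x" "2 * bal m x < m" by linarith+
qed

lemma dvd_bal_diff: "m dvd bal m x - x"
  by (simp add: bal_def)

lemma balanced_unique: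
  fixes m x y :: int
  assumes "- m \<le> 2 * x" "2 * x < m" "- m \<le> 2 * y" "2 * y < m" "m dvd x - y"
  shows "x = y"
proof -
  have "\<bar>x - y\<bar> < m" using assms by linarith
  then show ?thesis using assms(5) dvd_imp_le_int[of "x - y" m] by force
qed

lemma bal_id: "- m \<le> 2 * x \<Longrightarrow> 2 * x < m \<Longrightarrow> bal m x = x"
  using balanced_unique[of m "bal m x" x] bal_bounds[of m x] dvd_bal_diff[of m x] by force

text \<open>The summands are the powers of an \<open>n\<close>-th root of unity, which is 1 exactly
  when \<open>n\<close> divides \<open>m\<close>; otherwise the geometric sum vanishes.\<close>

lemma sum_roots_of_unity:
  fixes m :: int
  assumes "n > 0"
  shows "(\<Sum>j<n. cis (2 * pi * of_int m * (real j / real n))) = (if int n dvd m then of_nat n else 0)"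
proof -
  define w where "w = cis (2 * pi * (of_int m / real n))"
  have pw: "cis (2 * pi * of_int m * (real j / real n)) = w ^ j" for j
    unfolding w_def Complex.DeMoivre by (simp add: mult_ac)
  have w_n: "w ^ n = 1"
    unfolding w_def Complex.DeMoivre using assms cis_multiple_2pi[of "of_int m"] by (simp add: mult_ac)
  show ?thesis
  proof (cases "int n dvd m")
    case True
    then obtain q where "m = int n * q" by blast
    then have "w = 1" using assms cis_multiple_2pi[of "of_int q"] by (simp add: w_def)
    then show ?thesis using True by (simp only: pw) simp
  next
    case False
    have "w \<noteq> 1"
    proof
      assume "w = 1"
      then have "cos (2 * pi * (of_int m / real n)) = 1" by (simp add: w_def complex_eq_iff)
      then obtain q :: int where "2 * pi * (of_int m / real n) = of_int q * 2 * pi"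
        by (auto simp: cos_one_2pi_int)
      then have "of_int m = real_of_int (q * int n)"
        using assms by (simp add: field_simps)
      then have "m = q * int n" by (simp only: of_int_eq_iff)
      then show False using False by simp
    qed
    have "(\<Sum>j<n. w ^ j) = 0" using w_n by (simp add: geometric_sum[OF \<open>w \<noteq> 1\<close>])
    then show ?thesis using False by (simp only: pw if_False)
  qed
qed

section \<open>Digit systems\<close>

locale digit_system =
  fixes b N :: "nat \<Rightarrow> nat" and B :: "nat \<Rightarrow> nat set"
  assumes b_le_N: "b k \<le> N k" and b_ge_2: "2 \<le> b k" and b_dvd_N: "b k dvd N k"
    and finite_B: "finite (B k)"
    and bij_B: "bij_betw (\<lambda>x. x mod N k) (B k) {0..<b k}"
    and summable_bad: "summable (\<lambda>k. 1 / real (b k) * real (card (B k - {0..<b k})))"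
begin

definition Q :: "nat \<Rightarrow> nat" where "Q n = (\<Prod>i<n. N i)"

text \<open>The characteristic function, at \<open>2 * pi * y\<close>, of the uniform measure on the
  unscaled digits \<open>B k\<close>.\<close>

definition D :: "nat \<Rightarrow> real \<Rightarrow> complex" where
  "D k y = (\<Sum>d\<in>B k. cis (2 * pi * real d * y)) / of_nat (b k)"

definition phi :: "nat \<Rightarrow> real \<Rightarrow> complex" where
  "phi n t = (\<Prod>k<n. D k (t / real (Q (Suc k))))"

text \<open>The added multiple of \<open>Q n\<close> is invisible to \<open>phi n\<close>, while it
  shifts the argument of the new factor by \<open>j / b n\<close>. Taking \<open>bal\<close> changes
  the frequency by a multiple of the period of \<open>phi (Suc n)\<close>.\<close>

primrec Lam :: "nat \<Rightarrow> int set" where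
  "Lam 0 = {0}"
| "Lam (Suc n) = (\<lambda>(r, j). bal (int (Q (Suc n))) (r + int (Q n) * int (N n div b n) * int j)) `
     (Lam n \<times> {..<b n})"

lemma b_pos [simp]: "b k > 0" using b_ge_2[of k] by simp
lemma b_nonzero [simp]: "b k \<noteq> 0" using b_pos[of k] by linarith
lemma N_ge_2: "2 \<le> N k" using b_ge_2[of k] b_le_N[of k] by simp
lemma N_pos [simp]: "N k > 0" using N_ge_2[of k] by simp
lemma Q_pos [simp]: "Q n > 0" by (simp add: Q_def prod_pos)
lemma Q_nonzero [simp]: "Q n \<noteq> 0" using Q_pos[of n] by linarith
lemma Q_0 [simp]: "Q 0 = 1" by (simp add: Q_def)
lemma Q_Suc: "Q (Suc n) = Q n * N n" by (simp add: Q_def)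

lemma Q_dvd: "m \<le> n \<Longrightarrow> Q m dvd Q n"
  unfolding Q_def by (rule prod_dvd_prod_subset) auto

lemma Q_growth: "2 ^ i * Q n \<le> Q (n + i)"
proof (induction i)
  case (Suc i)
  have "2 ^ Suc i * Q n = 2 ^ i * Q n * 2" by simp
  also have "\<dots> \<le> Q (n + i) * N (n + i)" by (intro mult_mono Suc N_ge_2) auto
  finally show ?case by (simp add: Q_Suc)
qed simp

lemma card_B: "card (B k) = b k"
  using bij_betw_same_card[OF bij_B[of k]] by simp

lemma norm_D_le: "cmod (D k y) \<le> 1"
proof -
  have "cmod (\<Sum>d\<in>B k. cis (2 * pi * real d * y)) \<le> (\<Sum>d\<in>B k. cmod (cis (2 * pi * real d * y)))"
    by (rule norm_sum)
  also have "\<dots> = real (b k)" by (simp add: card_B)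
  finally show ?thesis by (simp add: D_def norm_divide)
qed

lemma D_period: "D k (y + of_int j) = D k y"
proof -
  have "cis (2 * pi * real d * (y + of_int j)) = cis (2 * pi * real d * y)" for d
  proof -
    have "cis (2 * pi * real d * (y + of_int j)) = cis (2 * pi * real d * y) * cis (2 * pi * (real d * of_int j))"
      by (simp add: cis_mult algebra_simps)
    then show ?thesis by (simp add: cis_multiple_2pi)
  qed
  then show ?thesis by (simp add: D_def)
qed

text \<open>Since \<open>b k\<close> divides \<open>N k\<close>, a congruence modulo
  \<open>b k\<close> passes to the residues modulo \<open>N k\<close>. These lie below
  \<open>b k\<close>, so they coincide, and reduction modulo \<open>N k\<close> is injective on the
  digits.\<close>

lemma B_cong_imp_eq:
  assumes "d \<in> B k" "d' \<in> B k" "int (b k) dvd int d - int d'"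
  shows "d = d'"
proof -
  have "d mod b k = d' mod b k"
    using assms(3) by (metis mod_eq_dvd_iff of_nat_eq_iff of_nat_mod)
  then have "(d mod N k) mod b k = (d' mod N k) mod b k"
    using b_dvd_N[of k] by (simp add: mod_mod_cancel)
  moreover have "d mod N k < b k" "d' mod N k < b k"
    using bij_betw_imp_surj_on[OF bij_B[of k]] assms by (auto simp: set_eq_iff image_iff)
  ultimately have "d mod N k = d' mod N k" by simp
  then show ?thesis
    using bij_betw_imp_inj_on[OF bij_B[of k]] assms by (auto dest: inj_onD)
qed

text \<open>After expanding the square, the sum over \<open>j\<close> runs over roots of unity and
  kills every pair of distinct digits, as these are incongruent modulo \<open>b k\<close>. The
  \<open>b k\<close> diagonal pairs contribute \<open>b k\<close> each.\<close>

lemma D_parseval: "(\<Sum>j<b k. (cmod (D k (y + real j / real (b k))))\<^sup>2) = 1"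
proof -
  have "complex_of_real (\<Sum>j<b k. (cmod (D k (y + real j / real (b k))))\<^sup>2) =
     (\<Sum>j<b k. \<Sum>d\<in>B k. \<Sum>d'\<in>B k. cis (2 * pi * (real d - real d') * y)
        * cis (2 * pi * of_int (int d - int d') * (real j / real (b k)))) / (of_nat (b k))\<^sup>2"
  proof -
    have sq: "complex_of_real ((cmod (D k z))\<^sup>2) =
        (\<Sum>d\<in>B k. \<Sum>d'\<in>B k. cis (2 * pi * (real d - real d') * z)) / (of_nat (b k))\<^sup>2" for z
    proof -
      have "complex_of_real ((cmod (D k z))\<^sup>2) =
        (\<Sum>d\<in>B k. \<Sum>d'\<in>B k. cis (2 * pi * real d * z) * cis (- (2 * pi * real d' * z))) / (of_nat (b k))\<^sup>2"
        by (subst complex_norm_square) (simp add: D_def cis_cnj sum_product power2_eq_square)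
      then show ?thesis by (simp add: cis_mult algebra_simps)
    qed
    have "cis (2 * pi * (real d - real d') * (y + real j / real (b k))) =
        cis (2 * pi * (real d - real d') * y)
          * cis (2 * pi * of_int (int d - int d') * (real j / real (b k)))" for d d' j
      by (simp add: cis_mult distrib_left)
    then show ?thesis
      by (simp only: of_real_sum sq sum_divide_distrib[symmetric])
  qed
  also have "(\<Sum>j<b k. \<Sum>d\<in>B k. \<Sum>d'\<in>B k. cis (2 * pi * (real d - real d') * y)
        * cis (2 * pi * of_int (int d - int d') * (real j / real (b k)))) =
      (\<Sum>d\<in>B k. \<Sum>d'\<in>B k. cis (2 * pi * (real d - real d') * y)
        * (\<Sum>j<b k. cis (2 * pi * of_int (int d - int d') * (real j / real (b k)))))"
    \<comment> \<open>Two exchanges move the sum over \<open>j\<close> to the innermost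
      place.\<close>
    by (subst sum.swap, rule sum.cong[OF refl], subst sum.swap) (simp only: sum_distrib_left)
  also have "\<dots> = (\<Sum>d\<in>B k. \<Sum>d'\<in>B k. if d' = d then of_nat (b k) else 0)"
    using B_cong_imp_eq by (intro sum.cong refl) (auto simp only: sum_roots_of_unity[OF b_pos] split: if_splits, auto)
  also have "\<dots> = (of_nat (b k))\<^sup>2"
    by (simp add: finite_B card_B power2_eq_square)
  finally show ?thesis
    by (simp add: complex_eq_iff)
qed

section \<open>Finite Fourier products and their frequency sets\<close>

lemma phi_0 [simp]: "phi 0 t = 1"
  by (simp add: phi_def)

lemma phi_Suc: "phi (Suc n) t = phi n t * D n (t / real (Q (Suc n)))"
  by (simp add: phi_def)

lemma phi_add: "phi (n + p) t = phi n t * (\<Prod>i<p. D (n + i) (t / real (Q (Suc (n + i)))))"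
  by (induction p) (simp_all add: phi_Suc mult_ac)

lemma norm_phi_add_le: "cmod (phi (n + p) t) \<le> cmod (phi n t)"
proof -
  have "cmod (\<Prod>i<p. D (n + i) (t / real (Q (Suc (n + i))))) \<le> 1"
    unfolding prod_norm[symmetric] by (intro prod_le_1) (auto simp: norm_D_le)
  then show ?thesis
    unfolding phi_add norm_mult by (intro mult_right_le_one_le) auto
qed

text \<open>Each factor has period \<open>Q (Suc k)\<close> in \<open>t\<close> with
  \<open>k < n\<close>, and all these numbers divide \<open>Q n\<close>.\<close>

lemma phi_period: "phi n (t + real (Q n) * of_int j) = phi n t"
  unfolding phi_def
proof (rule prod.cong[OF refl])
  fix k assume "k \<in> {..<n}"
  then have "Q (Suc k) dvd Q n" by (intro Q_dvd) auto
  then obtain q where q: "Q n = Q (Suc k) * q" by blast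
  have "(t + real (Q n) * of_int j) / real (Q (Suc k)) = t / real (Q (Suc k)) + of_int (int q * j)"
    using Q_pos[of "Suc k"] by (simp add: q field_simps)
  then show "D k ((t + real (Q n) * of_int j) / real (Q (Suc k))) = D k (t / real (Q (Suc k)))"
    by (simp only: D_period)
qed

lemma phi_cong: "int (Q n) dvd l - l' \<Longrightarrow> phi n (of_int l + t) = phi n (of_int l' + t)"
proof -
  assume "int (Q n) dvd l - l'"
  then obtain q where "l = l' + int (Q n) * q" by (metis dvd_def add.commute diff_eq_eq)
  then show ?thesis using phi_period[of n "of_int l' + t" q] by (simp add: algebra_simps)
qed

lemma finite_Lam: "finite (Lam n)"
  by (induction n) auto

lemma Lam_balanced: "l \<in> Lam n \<Longrightarrow> - int (Q n) \<le> 2 * l \<and> 2 * l < int (Q n)"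
  by (cases n) (auto simp: bal_bounds)

text \<open>Reducing modulo \<open>Q n\<close> recovers \<open>r\<close>, because elements of
  \<open>Lam n\<close> are balanced; what remains determines \<open>j\<close> modulo
  \<open>b n\<close>.\<close>

lemma inj_on_Lam:
  "inj_on (\<lambda>(r, j). bal (int (Q (Suc n))) (r + int (Q n) * int (N n div b n) * int j)) (Lam n \<times> {..<b n})"
proof (rule inj_onI, clarsimp)
  fix r j r' j'
  let ?M = "int (N n div b n)"
  assume r: "r \<in> Lam n" "r' \<in> Lam n" and j: "j < b n" "j' < b n"
    and eq: "bal (int (Q (Suc n))) (r + int (Q n) * ?M * int j)
        = bal (int (Q (Suc n))) (r' + int (Q n) * ?M * int j')"
  have M: "int (N n) = ?M * int (b n)"
    using b_dvd_N[of n] by (metis dvd_div_mult_self of_nat_mult)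
  then have Mpos: "?M > 0" using N_pos[of n] by (metis of_nat_0_less_iff zero_less_mult_pos2 b_pos)
  have "int (Q (Suc n)) dvd (r + int (Q n) * ?M * int j) - (r' + int (Q n) * ?M * int j')"
    using dvd_diff[OF dvd_bal_diff[of "int (Q (Suc n))" "r' + int (Q n) * ?M * int j'"]
        dvd_bal_diff[of "int (Q (Suc n))" "r + int (Q n) * ?M * int j"]] eq
    by (simp add: algebra_simps)
  then obtain q where q: "r + int (Q n) * ?M * int j - (r' + int (Q n) * ?M * int j')
      = int (Q n) * (?M * int (b n)) * q"
    by (auto simp: Q_Suc M)
  have "r - r' = int (Q n) * (?M * int (b n) * q - ?M * int j + ?M * int j')"
    using q by (simp add: algebra_simps)
  then have "int (Q n) dvd r - r'" by simp
  then have rr: "r = r'" using r Lam_balanced by (intro balanced_unique[of "int (Q n)"]) auto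
  with q have "int (Q n) * (?M * (int j - int j')) = int (Q n) * (?M * (int (b n) * q))"
    by (simp add: algebra_simps)
  then have jj: "int j - int j' = int (b n) * q" using Mpos by simp
  then have "int (b n) dvd int j - int j'" by simp
  then have "int j = int j'"
    using j dvd_imp_le_int[of "int j - int j'" "int (b n)"] by force
  with rr show "r = r' \<and> j = j'" by simp
qed

text \<open>Induction on \<open>n\<close>: for fixed \<open>r\<close>, the factor
  \<open>phi n\<close> is the same for all \<open>j\<close>, and the arguments of the new factor are
  spaced by \<open>1 / b n\<close>, so \<open>D_parseval\<close> sums over \<open>j\<close> to
  1.\<close>

lemma Lam_parseval: "(\<Sum>l\<in>Lam n. (cmod (phi n (of_int l + x)))\<^sup>2) = 1"
proof (induction n)
  case (Suc n)
  let ?M = "int (N n div b n)"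
  have MN: "real_of_int ?M / real (N n) = 1 / real (b n)"
    using b_dvd_N[of n] by (auto simp: real_of_nat_div field_simps)
  have eq: "phi (Suc n) (of_int (bal (int (Q (Suc n))) (r + int (Q n) * ?M * int j)) + x)
      = phi n (of_int r + x) * D n ((of_int r + x) / real (Q (Suc n)) + real j / real (b n))" for r j
  proof -
    let ?t = "r + int (Q n) * ?M * int j"
    have "phi (Suc n) (of_int (bal (int (Q (Suc n))) ?t) + x) = phi (Suc n) (of_int ?t + x)"
      by (rule phi_cong[OF dvd_bal_diff])
    also have "\<dots> = phi n (of_int ?t + x) * D n ((of_int ?t + x) / real (Q (Suc n)))"
      by (rule phi_Suc)
    also have "phi n (of_int ?t + x) = phi n (of_int r + x)"
      by (rule phi_cong) simp
    also have "(of_int ?t + x) / real (Q (Suc n)) =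
        (of_int r + x) / real (Q (Suc n)) + real_of_int ?M / real (N n) * real j"
      by (simp add: Q_Suc add_divide_distrib)
    finally show ?thesis by (simp only: MN) simp
  qed
  have "(\<Sum>l\<in>Lam (Suc n). (cmod (phi (Suc n) (of_int l + x)))\<^sup>2) =
      (\<Sum>(r, j)\<in>Lam n \<times> {..<b n}. (cmod (phi n (of_int r + x)))\<^sup>2 *
        (cmod (D n ((of_int r + x) / real (Q (Suc n)) + real j / real (b n))))\<^sup>2)"
    unfolding Lam.simps
    by (subst sum.reindex[OF inj_on_Lam]) (auto simp: eq norm_mult power_mult_distrib intro!: sum.cong)
  also have "\<dots> = (\<Sum>r\<in>Lam n. (cmod (phi n (of_int r + x)))\<^sup>2 *
        (\<Sum>j<b n. (cmod (D n ((of_int r + x) / real (Q (Suc n)) + real j / real (b n))))\<^sup>2))"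
    by (simp add: sum.cartesian_product[symmetric] sum_distrib_left)
  also have "\<dots> = 1" by (simp only: D_parseval mult_1_right Suc)
  finally show ?case .
qed simp

text \<open>In the Parseval identity translated by \<open>- l'\<close>, the term of
  \<open>l'\<close> itself is already \<open>|phi n 0|\<^sup>2 = 1\<close>, so every other term
  vanishes.\<close>

lemma Lam_orthogonal:
  assumes "l \<in> Lam n" "l' \<in> Lam n" "l \<noteq> l'"
  shows "phi n (of_int l - of_int l') = 0"
proof -
  have "(\<Sum>k\<in>{l, l'}. (cmod (phi n (of_int k + (- of_int l'))))\<^sup>2) \<le>
      (\<Sum>k\<in>Lam n. (cmod (phi n (of_int k + (- of_int l'))))\<^sup>2)"
    using assms finite_Lam by (intro sum_mono2) auto
  moreover have "phi n 0 = 1" by (simp add: phi_def D_def card_B)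
  ultimately show ?thesis using assms Lam_parseval[of n "- of_int l'"] by simp
qed

text \<open>The choice \<open>j = 0\<close> reproduces \<open>l\<close>: a balanced residue modulo
  \<open>Q n\<close> is also balanced modulo the larger \<open>Q (Suc n)\<close>.\<close>

lemma Lam_mono_Suc: "Lam n \<subseteq> Lam (Suc n)"
proof
  fix l assume l: "l \<in> Lam n"
  have "Q n \<le> Q (Suc n)" by (rule dvd_imp_le[OF Q_dvd]) auto
  then have "bal (int (Q (Suc n))) (l + int (Q n) * int (N n div b n) * int 0) = l"
    using Lam_balanced[OF l] by (simp add: bal_id)
  then show "l \<in> Lam (Suc n)"
    using l unfolding Lam.simps by (intro image_eqI[of _ _ "(l, 0)"]) auto
qed

lemma Lam_mono: "m \<le> n \<Longrightarrow> Lam m \<subseteq> Lam n"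
  by (rule lift_Suc_mono_le[of Lam]) (rule Lam_mono_Suc)

end

section \<open>Comparison with consecutive digits\<close>

lemma sum_centred_squares:
  "(\<Sum>j<n. (real j - (real n - 1) / 2)\<^sup>2) = real n * ((real n)\<^sup>2 - 1) / 12"
proof -
  \<comment> \<open>The centre depends on \<open>n\<close>, so the induction is carried out for an
    arbitrary \<open>c\<close>.\<close>
  have "(\<Sum>j<n. (real j - c)\<^sup>2)
      = real n * (real n - 1) * (2 * real n - 1) / 6 - c * real n * (real n - 1) + real n * c\<^sup>2" for c
    by (induction n) (simp_all add: power2_eq_square field_simps)
  from this[of "(real n - 1) / 2"] show ?thesis
    by (simp only:) (simp add: power2_eq_square field_simps)
qed

text \<open>Centring the progression makes the sum of its exponentials real up to a rotation, and
  \<open>cos x \<ge> 1 - x\<^sup>2 / 2\<close> can be summed termwise.\<close>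

lemma norm_sum_cis_ge:
  "real n * (1 - \<theta>\<^sup>2 * (real n)\<^sup>2 / 24) \<le> cmod (\<Sum>j<n. cis (real j * \<theta>))"
proof -
  define c where "c = (real n - 1) / 2"
  have cos_ge: "1 - x\<^sup>2 / 2 \<le> cos x" for x :: real
  proof -
    have "cos x = 1 - 2 * (sin (x / 2))\<^sup>2" using cos_double_sin[of "x / 2"] by simp
    moreover have "(sin (x / 2))\<^sup>2 \<le> (x / 2)\<^sup>2"
      using abs_sin_x_le_abs_x[of "x / 2"] by (simp only: abs_le_square_iff)
    ultimately show ?thesis by (simp add: power_divide)
  qed
  have "(\<Sum>j<n. (real j - c)\<^sup>2) \<le> real n * (real n)\<^sup>2 / 12"
    unfolding c_def sum_centred_squares by (simp add: field_simps)
  then have "\<theta>\<^sup>2 / 2 * (\<Sum>j<n. (real j - c)\<^sup>2) \<le> \<theta>\<^sup>2 / 2 * (real n * (real n)\<^sup>2 / 12)"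
    by (intro mult_left_mono) auto
  then have "real n * (1 - \<theta>\<^sup>2 * (real n)\<^sup>2 / 24) \<le> real n - \<theta>\<^sup>2 / 2 * (\<Sum>j<n. (real j - c)\<^sup>2)"
    by (simp add: algebra_simps)
  also have "\<dots> = (\<Sum>j<n. 1 - ((real j - c) * \<theta>)\<^sup>2 / 2)"
    by (simp add: sum_subtractf sum_distrib_left power_mult_distrib mult_ac)
  also have "\<dots> \<le> (\<Sum>j<n. cos ((real j - c) * \<theta>))"
    by (intro sum_mono cos_ge)
  also have "\<dots> = Re (\<Sum>j<n. cis ((real j - c) * \<theta>))"
    by simp
  also have "(\<Sum>j<n. cis ((real j - c) * \<theta>)) = cis (- c * \<theta>) * (\<Sum>j<n. cis (real j * \<theta>))"
    by (simp add: sum_distrib_left cis_mult algebra_simps)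
  also have "Re \<dots> \<le> cmod \<dots>" by (rule complex_Re_le_cmod)
  also have "\<dots> = cmod (\<Sum>j<n. cis (real j * \<theta>))" by (simp add: norm_mult)
  finally show ?thesis .
qed

lemma sum_quarter_powers_le: "(\<Sum>i<p. (1 / 4 :: real) ^ i) \<le> 4 / 3"
  unfolding sum_gp_strict by simp

context digit_system
begin

definition bad :: "nat \<Rightarrow> real" where
  "bad k = 1 / real (b k) * real (card (B k - {0..<b k}))"

lemma bad_nonneg: "0 \<le> bad k"
  by (simp add: bad_def)

lemma summable_bad': "summable bad"
  using summable_bad by (simp add: bad_def[abs_def])

text \<open>The counterpart of \<open>D k\<close> for exactly consecutive digits.\<close>

definition C :: "nat \<Rightarrow> real \<Rightarrow> complex" where
  "C k y = (\<Sum>d<b k. cis (2 * pi * real d * y)) / of_nat (b k)"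

text \<open>Common digits cancel. Both digit sets have \<open>b k\<close> elements, so there are as
  many missing consecutive digits as stray ones, and each contributes a term of modulus 1; hence the
  factor 2.\<close>

lemma norm_D_minus_C_le: "cmod (D k y - C k y) \<le> 2 * bad k"
proof -
  let ?e = "\<lambda>d::nat. cis (2 * pi * real d * y)"
  have fin: "finite (B k)" by (rule finite_B)
  have 1: "sum ?e (B k) = sum ?e (B k \<inter> {..<b k}) + sum ?e (B k - {..<b k})"
    using sum.Int_Diff[OF fin] by blast
  have 2: "sum ?e {..<b k} = sum ?e ({..<b k} \<inter> B k) + sum ?e ({..<b k} - B k)"
    using sum.Int_Diff by blast
  have "card (B k - {..<b k}) + card (B k \<inter> {..<b k}) = b k"
    using card_Diff_subset_Int[of "B k" "{..<b k}"] fin card_B[of k] card_mono[OF fin, of "B k \<inter> {..<b k}"] by auto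
  moreover have "card ({..<b k} - B k) + card (B k \<inter> {..<b k}) = b k"
    using card_Diff_subset_Int[of "{..<b k}" "B k"] card_mono[of "{..<b k}" "B k \<inter> {..<b k}"] fin
    by (auto simp: Int_commute)
  ultimately have card: "card ({..<b k} - B k) = card (B k - {..<b k})" by simp
  have "cmod (sum ?e (B k) - sum ?e {..<b k}) = cmod (sum ?e (B k - {..<b k}) - sum ?e ({..<b k} - B k))"
    by (simp add: 1 2 Int_commute)
  also have "\<dots> \<le> cmod (sum ?e (B k - {..<b k})) + cmod (sum ?e ({..<b k} - B k))"
    by (rule norm_triangle_ineq4)
  also have "\<dots> \<le> real (card (B k - {..<b k})) + real (card ({..<b k} - B k))"
    using norm_sum[of ?e "B k - {..<b k}"] norm_sum[of ?e "{..<b k} - B k"] by simp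
  also have "\<dots> = 2 * real (card (B k - {..<b k}))" by (simp add: card)
  finally have "cmod (sum ?e (B k) - sum ?e {..<b k}) / real (b k)
      \<le> 2 * real (card (B k - {..<b k})) / real (b k)"
    by (intro divide_right_mono) auto
  then show ?thesis
    by (simp add: D_def C_def bad_def diff_divide_distrib[symmetric] norm_divide lessThan_atLeast0)
qed

lemma norm_C_minus_1_le: "cmod (C k y - 1) \<le> 2 * pi * (real (b k) * \<bar>y\<bar>)"
proof -
  have "C k y - 1 = (\<Sum>d<b k. cis (2 * pi * real d * y) - 1) / of_nat (b k)"
    by (simp add: C_def sum_subtractf diff_divide_distrib)
  moreover have "cmod (\<Sum>d<b k. cis (2 * pi * real d * y) - 1) \<le> (\<Sum>d<b k. 2 * pi * (real (b k) * \<bar>y\<bar>))"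
  proof (intro sum_norm_le)
    fix d assume d: "d \<in> {..<b k}"
    have "cmod (cis (2 * pi * real d * y) - 1) \<le> \<bar>2 * pi * real d * y\<bar>"
      using iexp_approx1[of "2 * pi * real d * y" 0] by (simp add: cis_conv_exp)
    also have "\<dots> = 2 * pi * (real d * \<bar>y\<bar>)" by (simp add: abs_mult)
    also have "\<dots> \<le> 2 * pi * (real (b k) * \<bar>y\<bar>)"
      using d by (intro mult_left_mono mult_right_mono) auto
    finally show "cmod (cis (2 * pi * real d * y) - 1) \<le> 2 * pi * (real (b k) * \<bar>y\<bar>)" .
  qed
  ultimately show ?thesis by (simp add: norm_divide divide_le_eq mult_ac)
qed

text \<open>This is \<open>norm_sum_cis_ge\<close> at the angle \<open>2 * pi * y\<close>; the
  constant comes from \<open>(2 * pi)\<^sup>2 / 24 \<le> 4 * 16 / 24 = 8 / 3\<close>.\<close>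

lemma norm_C_ge: "1 - 8 / 3 * (real (b k) * y)\<^sup>2 \<le> cmod (C k y)"
proof -
  have "pi\<^sup>2 \<le> 4\<^sup>2" using pi_less_4 pi_gt_zero by (intro power_mono) auto
  then have "pi\<^sup>2 * (real (b k) * y)\<^sup>2 \<le> 16 * (real (b k) * y)\<^sup>2"
    by (intro mult_right_mono) auto
  then have "1 - 8 / 3 * (real (b k) * y)\<^sup>2 \<le> 1 - (2 * pi * y)\<^sup>2 * (real (b k))\<^sup>2 / 24"
    by (simp add: power_mult_distrib mult_ac)
  also have "\<dots> \<le> cmod (\<Sum>j<b k. cis (real j * (2 * pi * y))) / real (b k)"
    using norm_sum_cis_ge[of "b k" "2 * pi * y"] by (simp add: pos_le_divide_eq mult_ac)
  finally show ?thesis by (simp add: C_def norm_divide mult_ac)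
qed

lemma b_scaled_le: "real (b k) * \<bar>t / real (Q (Suc k))\<bar> \<le> \<bar>t\<bar> / real (Q k)"
proof -
  have "real (b k) * \<bar>t / real (Q (Suc k))\<bar> = \<bar>t\<bar> / real (Q k) * (real (b k) / real (N k))"
    by (simp add: Q_Suc)
  also have "\<dots> \<le> \<bar>t\<bar> / real (Q k) * 1"
    using b_le_N[of k] N_pos[of k] by (intro mult_left_mono) (auto simp: divide_le_eq_1)
  finally show ?thesis by simp
qed

lemma inverse_Q_le: "1 / real (Q k) \<le> (1 / 2) ^ k"
proof -
  have "real (2 ^ k * Q 0) \<le> real (Q (0 + k))" using Q_growth[of k 0] by (simp only: of_nat_le_iff)
  then show ?thesis by (simp add: power_divide frac_le)
qed

section \<open>The limit transform and its lower bound\<close>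

lemma convergent_phi: "convergent (\<lambda>n. phi n t)"
proof -
  have "summable (\<lambda>k. cmod (D k (t / real (Q (Suc k))) - 1))"
  proof (rule summable_comparison_test')
    show "summable (\<lambda>k. 2 * bad k + 2 * pi * \<bar>t\<bar> * (1 / 2) ^ k)"
      by (intro summable_add summable_mult summable_bad' summable_geometric) auto
    fix k
    let ?y = "t / real (Q (Suc k))"
    \<comment> \<open>Stray digits cost \<open>2 * bad k\<close>; consecutive digits cost at most
      \<open>2 * pi * |t| / Q k\<close>, which decays geometrically.\<close>
    have "cmod (D k ?y - 1) \<le> cmod (D k ?y - C k ?y) + cmod (C k ?y - 1)"
      using norm_triangle_ineq[of "D k ?y - C k ?y" "C k ?y - 1"] by simp
    also have "\<dots> \<le> 2 * bad k + 2 * pi * (real (b k) * \<bar>?y\<bar>)"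
      by (intro add_mono norm_D_minus_C_le norm_C_minus_1_le)
    also have "real (b k) * \<bar>?y\<bar> \<le> \<bar>t\<bar> * (1 / real (Q k))" using b_scaled_le[of k t] by simp
    also have "\<dots> \<le> \<bar>t\<bar> * (1 / 2) ^ k" by (intro mult_left_mono inverse_Q_le) auto
    finally show "norm (cmod (D k ?y - 1)) \<le> 2 * bad k + 2 * pi * \<bar>t\<bar> * (1 / 2) ^ k"
      by (simp add: mult_ac)
  qed
  then have "convergent_prod (\<lambda>k. D k (t / real (Q (Suc k))))"
    by (intro abs_convergent_prod_imp_convergent_prod summable_imp_abs_convergent_prod)
  then have "convergent (\<lambda>n. phi (Suc n) t)"
    using convergent_prod_imp_convergent by (simp add: phi_def lessThan_Suc_atMost)
  then obtain L where "(\<lambda>n. phi (Suc n) t) \<longlonglongrightarrow> L" by (auto simp: convergent_def)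
  then have "(\<lambda>n. phi n t) \<longlonglongrightarrow> L" by (rule LIMSEQ_imp_Suc)
  then show ?thesis by (rule convergentI)
qed

definition phi_lim :: "real \<Rightarrow> complex" where "phi_lim t = lim (\<lambda>n. phi n t)"

lemma phi_tendsto: "(\<lambda>n. phi n t) \<longlonglongrightarrow> phi_lim t"
  unfolding phi_lim_def using convergent_phi by (simp add: convergent_LIMSEQ_iff)

lemma norm_phi_lim_le: "cmod (phi_lim t) \<le> cmod (phi n t)"
proof (rule LIMSEQ_le_const2[OF tendsto_norm[OF phi_tendsto]])
  show "\<exists>m. \<forall>k\<ge>m. cmod (phi k t) \<le> cmod (phi n t)"
    using norm_phi_add_le[of n _ t] by (metis le_iff_add)
qed

text \<open>For \<open>l\<close> in \<open>Lam n\<close> one has \<open>|l| \<le> Q n / 2\<close>, so a fixed translate of \<open>l\<close> satisfies the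
  hypothesis on \<open>t\<close> for large \<open>n\<close>; a radius slightly larger than a half is still inside the region
  where the quadratic bound on the factors gives a positive product.\<close>

lemma norm_tail_product_ge:
  assumes t: "\<bar>t\<bar> \<le> 51 / 100 * real (Q n)" and tail: "(\<Sum>i. bad (n + i)) \<le> 1 / 100"
  shows "1 / 50 \<le> cmod (\<Prod>i<p. D (n + i) (t / real (Q (Suc (n + i)))))"
proof -
  define y where "y i = t / real (Q (Suc (n + i)))" for i
  define z where "z i = cmod (D (n + i) (y i))" for i
  \<comment> \<open>The growth of \<open>Q\<close> halves the bound on
    \<open>b (n + i) * |y i|\<close> at each index, so its square decays like
    \<open>(1 / 4) ^ i\<close>; replacing \<open>C\<close> by \<open>D\<close> costs
    \<open>2 * bad (n + i)\<close>.\<close>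
  have z: "1 - z i \<le> 2 * bad (n + i) + 8 / 3 * (51 / 100)\<^sup>2 * (1 / 4) ^ i" for i
  proof -
    have "real (2 ^ i * Q n) \<le> real (Q (n + i))" using Q_growth by (simp only: of_nat_le_iff)
    then have q: "2 ^ i * real (Q n) \<le> real (Q (n + i))" by simp
    have "real (b (n + i)) * \<bar>y i\<bar> \<le> \<bar>t\<bar> / real (Q (n + i))"
      unfolding y_def by (rule b_scaled_le)
    also have "\<dots> \<le> (51 / 100 * real (Q n)) / (2 ^ i * real (Q n))"
      using t q by (intro frac_le) auto
    also have "\<dots> = 51 / 100 * (1 / 2) ^ i" by (simp add: power_divide)
    finally have "(real (b (n + i)) * \<bar>y i\<bar>)\<^sup>2 \<le> (51 / 100 * (1 / 2) ^ i)\<^sup>2"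
      by (intro power_mono) auto
    also have "\<dots> = (51 / 100)\<^sup>2 * (1 / 4) ^ i"
    proof -
      have "((1 / 2) ^ i)\<^sup>2 = (1 / 4 :: real) ^ i"
        by (simp add: power2_eq_square flip: power_mult_distrib)
      then show ?thesis by (simp only: power_mult_distrib)
    qed
    finally have "(real (b (n + i)) * y i)\<^sup>2 \<le> (51 / 100)\<^sup>2 * (1 / 4) ^ i"
      by (simp add: power_mult_distrib)
    moreover have "1 - 8 / 3 * (real (b (n + i)) * y i)\<^sup>2 \<le> cmod (C (n + i) (y i))"
      by (rule norm_C_ge)
    moreover have "cmod (C (n + i) (y i)) \<le> z i + 2 * bad (n + i)"
      using norm_triangle_ineq2[of "C (n + i) (y i)" "D (n + i) (y i)"] norm_D_minus_C_le[of "n + i" "y i"]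
      by (simp add: z_def norm_minus_commute)
    ultimately show ?thesis by (simp add: algebra_simps)
  qed
  have z01: "1 - z i \<in> {0..1}" for i
    using norm_D_le[of "n + i" "y i"] by (simp add: z_def)
  have "(\<Sum>i<p. bad (n + i)) \<le> (\<Sum>i. bad (n + i))"
    using summable_ignore_initial_segment[OF summable_bad', of n] bad_nonneg
    by (intro sum_le_suminf) (auto simp: add.commute)
  then have bad_sum: "(\<Sum>i<p. bad (n + i)) \<le> 1 / 100" using tail by simp
  have "(\<Sum>i<p. 1 - z i) \<le> (\<Sum>i<p. 2 * bad (n + i) + 8 / 3 * (51 / 100)\<^sup>2 * (1 / 4) ^ i)"
    by (intro sum_mono z)
  also have "\<dots> = 2 * (\<Sum>i<p. bad (n + i)) + 8 / 3 * (51 / 100)\<^sup>2 * (\<Sum>i<p. (1 / 4) ^ i)"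
    by (simp add: sum.distrib sum_distrib_left)
  also have "\<dots> \<le> 2 * (1 / 100) + 8 / 3 * (51 / 100)\<^sup>2 * (4 / 3)"
    by (intro add_mono mult_left_mono bad_sum sum_quarter_powers_le) auto
  \<comment> \<open>The total is about 0.945. That it stays below 1 is what the Weierstrass
    inequality needs to bound the product away from zero.\<close>
  also have "\<dots> \<le> 49 / 50" by (simp add: power2_eq_square)
  finally have "1 / 50 \<le> 1 - (\<Sum>i<p. 1 - z i)" by simp
  also have "\<dots> \<le> (\<Prod>i<p. 1 - (1 - z i))"
    by (rule Weierstrass_prod_ineq) (rule z01)
  also have "\<dots> = cmod (\<Prod>i<p. D (n + i) (y i))" by (simp add: z_def prod_norm)
  finally show ?thesis by (simp only: y_def)
qed

lemma eventually_norm_phi_lim_ge: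
  "\<exists>n0. \<forall>n\<ge>n0. \<forall>l\<in>Lam n. 1 / 50 * cmod (phi n (of_int l + x)) \<le> cmod (phi_lim (of_int l + x))"
proof -
  have "(\<lambda>n. \<Sum>i. bad (i + n)) \<longlonglongrightarrow> 0"
    by (rule suminf_exist_split2[OF summable_bad'])
  then have "eventually (\<lambda>n. (\<Sum>i. bad (i + n)) < 1 / 100) sequentially"
    by (rule order_tendstoD) simp
  then obtain n1 where n1: "\<And>n. n \<ge> n1 \<Longrightarrow> (\<Sum>i. bad (i + n)) < 1 / 100"
    by (auto simp: eventually_sequentially)
  \<comment> \<open>Together with \<open>n \<le> Q n\<close> this makes \<open>|x|\<close> at most a
    hundredth of \<open>Q n\<close>; added to the half from \<open>Lam_balanced\<close> it gives the
    radius \<open>51 / 100\<close>.\<close>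
  obtain n2 :: nat where n2: "100 * \<bar>x\<bar> < real n2" using reals_Archimedean2 by blast
  show ?thesis
  proof (intro exI allI impI ballI)
    fix n l assume n: "max n1 n2 \<le> n" and l: "l \<in> Lam n"
    have "real n \<le> 2 ^ n" using of_nat_less_two_power[of n, where 'a = real] by simp
    also have "\<dots> = real (2 ^ n * Q 0)" by simp
    also have "\<dots> \<le> real (Q (0 + n))" unfolding of_nat_le_iff by (rule Q_growth)
    also have "\<dots> = real (Q n)" by simp
    finally have x: "100 * \<bar>x\<bar> \<le> real (Q n)" using n2 n by linarith
    have "\<bar>2 * l\<bar> \<le> int (Q n)" using Lam_balanced[OF l] by linarith
    then have "real_of_int \<bar>2 * l\<bar> \<le> real_of_int (int (Q n))" by (simp only: of_int_le_iff)
    then have "\<bar>2 * real_of_int l\<bar> \<le> real (Q n)" by simp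
    then have t: "\<bar>of_int l + x\<bar> \<le> 51 / 100 * real (Q n)" using x by linarith
    have tail: "(\<Sum>i. bad (n + i)) \<le> 1 / 100" using n1[of n] n by (simp add: add.commute)
    have "1 / 50 * cmod (phi n (of_int l + x)) \<le> cmod (phi (n + p) (of_int l + x))" for p
      unfolding phi_add norm_mult mult.commute[of "1 / 50"]
      by (intro mult_left_mono norm_tail_product_ge[OF t tail]) auto
    then have "1 / 50 * cmod (phi n (of_int l + x)) \<le> cmod (phi m (of_int l + x))" if "m \<ge> n" for m
      using le_Suc_ex[OF that] by blast
    then show "1 / 50 * cmod (phi n (of_int l + x)) \<le> cmod (phi_lim (of_int l + x))"
      by (intro LIMSEQ_le_const[OF tendsto_norm[OF phi_tendsto]]) blast
  qed
qed

text \<open>Dominated convergence by hand: the finite-level terms sum to 1, converge termwise to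
  those of the limit, and are eventually at most \<open>50\<^sup>2 = 2500\<close> times them. The
  last bound prevents mass from escaping to frequencies outside a fixed
  \<open>Lam m\<close>.\<close>

lemma phi_lim_complete:
  assumes "\<epsilon> > 0"
  shows "\<exists>n. 1 - \<epsilon> < (\<Sum>l\<in>Lam n. (cmod (phi_lim (of_int l + x)))\<^sup>2)"
proof -
  define a where "a l = (cmod (phi_lim (of_int l + x)))\<^sup>2" for l
  define a' where "a' n l = (cmod (phi n (of_int l + x)))\<^sup>2" for n l
  define S where "S n = (\<Sum>l\<in>Lam n. a l)" for n
  obtain n0 where n0: "\<And>n l. n \<ge> n0 \<Longrightarrow> l \<in> Lam n \<Longrightarrow>
      1 / 50 * cmod (phi n (of_int l + x)) \<le> cmod (phi_lim (of_int l + x))"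
    using eventually_norm_phi_lim_ge by blast
  have a'_le: "a' n l \<le> 2500 * a l" if "n \<ge> n0" "l \<in> Lam n" for n l
  proof -
    have "(cmod (phi n (of_int l + x)))\<^sup>2 \<le> (50 * cmod (phi_lim (of_int l + x)))\<^sup>2"
      using n0[OF that] by (intro power_mono) auto
    then show ?thesis by (simp add: a_def a'_def power_mult_distrib)
  qed
  have a_le: "a l \<le> a' n l" for n l
    unfolding a_def a'_def by (intro power_mono norm_phi_lim_le) auto
  have sum_a': "(\<Sum>l\<in>Lam n. a' n l) = 1" for n
    unfolding a'_def by (rule Lam_parseval)
  have a'_tendsto: "(\<lambda>n. a' n l) \<longlonglongrightarrow> a l" for l
    unfolding a_def a'_def by (intro tendsto_intros phi_tendsto)
  have "incseq S"
    unfolding S_def incseq_def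
    by (intro allI impI sum_mono2 finite_Lam Lam_mono) (auto simp: a_def)
  moreover have "S n \<le> 1" for n
    unfolding S_def sum_a'[of n, symmetric] by (intro sum_mono a_le)
  ultimately obtain L where L: "S \<longlonglongrightarrow> L" using incseq_convergent by metis
  \<comment> \<open>At level \<open>n\<close> the total 1 is split into the part over
    \<open>Lam m\<close> and the rest, which is at most \<open>2500 * (S n - S m)\<close>; then
    \<open>n\<close> tends to infinity with \<open>m\<close> fixed.\<close>
  have step: "1 \<le> S m + 2500 * (L - S m)" for m
  proof (rule LIMSEQ_le_const)
    show "(\<lambda>n. (\<Sum>l\<in>Lam m. a' n l) + 2500 * (S n - S m)) \<longlonglongrightarrow> S m + 2500 * (L - S m)"
      unfolding S_def[of m] by (intro tendsto_intros a'_tendsto L)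
    show "\<exists>k. \<forall>n\<ge>k. 1 \<le> (\<Sum>l\<in>Lam m. a' n l) + 2500 * (S n - S m)"
    proof (intro exI allI impI)
      fix n assume n: "max m n0 \<le> n"
      then have sub: "Lam m \<subseteq> Lam n" by (intro Lam_mono) auto
      have "1 = (\<Sum>l\<in>Lam n - Lam m. a' n l) + (\<Sum>l\<in>Lam m. a' n l)"
        using sum.subset_diff[OF sub finite_Lam, of "a' n"] sum_a'[of n] by simp
      also have "(\<Sum>l\<in>Lam n - Lam m. a' n l) \<le> (\<Sum>l\<in>Lam n - Lam m. 2500 * a l)"
        using n by (intro sum_mono a'_le) auto
      also have "\<dots> = 2500 * (S n - S m)"
        unfolding S_def by (simp only: sum_diff[OF finite_Lam sub] sum_distrib_left[symmetric])
      finally show "1 \<le> (\<Sum>l\<in>Lam m. a' n l) + 2500 * (S n - S m)" by simp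
    qed
  qed
  \<comment> \<open>Now \<open>m\<close> tends to infinity: the escaping mass vanishes and
    \<open>1 \<le> L\<close> remains.\<close>
  have "(\<lambda>m. S m + 2500 * (L - S m)) \<longlonglongrightarrow> L + 2500 * (L - L)"
    by (intro tendsto_intros L)
  then have "1 \<le> L + 2500 * (L - L)"
    using step by (intro LIMSEQ_le_const) auto
  then have "eventually (\<lambda>n. 1 - \<epsilon> < S n) sequentially"
    using assms by (intro order_tendstoD(1)[OF L]) simp
  then obtain n where "1 - \<epsilon> < S n" by (auto simp: eventually_sequentially)
  then show ?thesis unfolding S_def a_def by (rule exI)
qed

end

section \<open>Convolutions of uniform measures\<close>

lemma measurable_uniform_count_measure:
  "f \<in> measurable (uniform_count_measure A) borel"
  by (simp add: measurable_def space_uniform_count_measure sets_uniform_count_measure)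

lemma real_distribution_uniform_delta:
  assumes "finite A" "A \<noteq> {}"
  shows "real_distribution (uniform_delta A)"
proof -
  interpret prob_space "uniform_count_measure A" using assms by (rule prob_space_uniform_count_measure)
  show ?thesis
    unfolding uniform_delta_def by (rule real_distribution_distr) (rule measurable_uniform_count_measure)
qed

lemma char_uniform_delta:
  assumes "finite A"
  shows "char (uniform_delta A) t = (\<Sum>a\<in>A. iexp (t * a)) / of_nat (card A)"
proof -
  have "char (uniform_delta A) t = (CLINT a|uniform_count_measure A. iexp (t * a))"
    unfolding char_def uniform_delta_def
    by (rule integral_distr) (auto simp: measurable_uniform_count_measure)
  also have "\<dots> = (\<Sum>a\<in>A. (1 / real (card A)) *\<^sub>R iexp (t * a))"
    unfolding uniform_count_measure_def
    using assms by (subst lebesgue_integral_point_measure_finite) auto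
  also have "\<dots> = (\<Sum>a\<in>A. iexp (t * a)) / of_nat (card A)"
    by (simp add: scaleR_conv_of_real sum_divide_distrib)
  finally show ?thesis .
qed

lemma measure_uniform_delta:
  assumes "finite A" "E \<in> sets borel"
  shows "measure (uniform_delta A) E = real (card (A \<inter> E)) / real (card A)"
proof -
  have "measure (uniform_delta A) E = measure (uniform_count_measure A) (E \<inter> A)"
    unfolding uniform_delta_def using assms(2)
    by (subst measure_distr) (auto simp: measurable_uniform_count_measure space_uniform_count_measure)
  then show ?thesis
    using assms by (simp add: measure_uniform_count_measure Int_commute)
qed

context
  fixes M N :: "real measure"
  assumes M: "real_distribution M" and N: "real_distribution N"
begin

interpretation M: real_distribution M by (rule M)
interpretation N: real_distribution N by (rule N)
interpretation MN: pair_prob_space M N ..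

lemma measurable_add_pair: "(\<lambda>(x, y). x + y) \<in> borel_measurable (M \<Otimes>\<^sub>M N)"
  by measurable

lemma real_distribution_convolution: "real_distribution (convolution M N)"
  unfolding convolution_def
  by (rule MN.P.real_distribution_distr) (rule measurable_add_pair)

lemma char_convolution: "char (convolution M N) t = char M t * char N t"
proof -
  have "char (convolution M N) t = (CLINT z|M \<Otimes>\<^sub>M N. iexp (t * (case z of (x, y) \<Rightarrow> x + y)))"
    unfolding char_def convolution_def by (rule integral_distr[OF measurable_add_pair]) measurable
  also have "\<dots> = (CLINT z|M \<Otimes>\<^sub>M N. (case z of (x, y) \<Rightarrow> iexp (t * x) * iexp (t * y)))"
    by (intro Bochner_Integration.integral_cong)
      (auto simp: distrib_left exp_add split: prod.splits)
  also have "\<dots> = (CLINT x|M. CLINT y|N. iexp (t * x) * iexp (t * y))"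
  proof (rule MN.integral_fst[symmetric])
    show "integrable (M \<Otimes>\<^sub>M N) (\<lambda>(x, y). iexp (t * x) * iexp (t * y))"
      by (rule MN.P.integrable_const_bound[of _ 1]) (auto simp: norm_mult)
  qed
  also have "\<dots> = char M t * char N t"
    by (simp add: char_def)
  finally show ?thesis .
qed

text \<open>Addition maps the box \<open>{0..r} \<times> {0..s}\<close> into
  \<open>{0..r + s}\<close>.\<close>

lemma measure_convolution_ge:
  "measure M {0..r} * measure N {0..s} \<le> measure (convolution M N) {0..r + s}"
proof -
  have "measure M {0..r} * measure N {0..s} = measure (M \<Otimes>\<^sub>M N) ({0..r} \<times> {0..s})"
    by (simp add: measure_def N.emeasure_pair_measure_Times enn2real_mult)
  also have "\<dots> \<le> measure (M \<Otimes>\<^sub>M N) ((\<lambda>(x, y). x + y) -` {0..r + s} \<inter> space (M \<Otimes>\<^sub>M N))"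
    using measurable_sets[OF measurable_add_pair, of "{0..r + s}"]
    by (intro MN.P.finite_measure_mono) (auto simp: space_pair_measure)
  also have "\<dots> = measure (convolution M N) {0..r + s}"
    unfolding convolution_def by (rule measure_distr[OF measurable_add_pair, symmetric]) simp
  finally show ?thesis .
qed

end

section \<open>Tightness and weak limits of finite convolutions\<close>

lemma real_distribution_finite_convolution:
  "(\<And>k. real_distribution (M k)) \<Longrightarrow> real_distribution (finite_convolution M n)"
  by (induction n) (simp_all add: real_distribution_convolution)

lemma char_finite_convolution:
  "(\<And>k. real_distribution (M k)) \<Longrightarrow> char (finite_convolution M n) t = (\<Prod>k\<le>n. char (M k) t)"
  by (induction n) (simp_all add: char_convolution real_distribution_finite_convolution)

lemma measure_finite_convolution_ge:
  assumes "\<And>k. real_distribution (M k)"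
  shows "(\<Prod>k\<le>n. measure (M k) {0..w k}) \<le> measure (finite_convolution M n) {0..\<Sum>k\<le>n. w k}"
proof (induction n)
  case (Suc n)
  have "(\<Prod>k\<le>Suc n. measure (M k) {0..w k})
      \<le> measure (finite_convolution M n) {0..\<Sum>k\<le>n. w k} * measure (M (Suc n)) {0..w (Suc n)}"
    using Suc by (simp add: mult_right_mono)
  also have "\<dots> \<le> measure (finite_convolution M (Suc n)) {0..(\<Sum>k\<le>n. w k) + w (Suc n)}"
    unfolding finite_convolution.simps
    by (intro measure_convolution_ge real_distribution_finite_convolution assms)
  finally show ?case by simp
qed simp

text \<open>In terms of independent summands: all of them lie in their windows
  \<open>{0..w k}\<close> with probability at least \<open>1 - suminf e\<close>, and then every
  partial sum lies between 0 and \<open>suminf w\<close>.\<close>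

lemma tight_finite_convolution:
  assumes M: "\<And>k. real_distribution (M k)"
    and ex: "\<And>\<epsilon>. \<epsilon> > 0 \<Longrightarrow> \<exists>w e. (\<forall>k. 0 \<le> w k) \<and> summable w \<and> (\<forall>k. 0 \<le> e k) \<and> summable e
      \<and> suminf e < \<epsilon> \<and> (\<forall>k. 1 - e k \<le> measure (M k) {0..w k})"
  shows "tight (finite_convolution M)"
  unfolding tight_def
proof (intro conjI allI impI)
  show "real_distribution (finite_convolution M n)" for n
    by (rule real_distribution_finite_convolution[OF M])
  fix \<epsilon> :: real assume "\<epsilon> > 0"
  with ex obtain w e where w: "\<And>k. 0 \<le> w k" "summable w" and e: "\<And>k. 0 \<le> e k" "summable e"
      "suminf e < \<epsilon>" and p: "\<And>k. 1 - e k \<le> measure (M k) {0..w k}" by metis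
  show "\<exists>a c. a < c \<and> (\<forall>n. 1 - \<epsilon> < measure (finite_convolution M n) {a<..c})"
  proof (intro exI conjI allI)
    \<comment> \<open>Tightness is stated with intervals open on the left, so the left end is -1 in
      order to include 0.\<close>
    show "- 1 < suminf w" using suminf_nonneg[OF w(2,1)] by simp
    fix n
    interpret F: real_distribution "finite_convolution M n"
      by (rule real_distribution_finite_convolution[OF M])
    have p01: "measure (M k) {0..w k} \<in> {0..1}" for k
    proof -
      interpret real_distribution "M k" by (rule M)
      show ?thesis by simp
    qed
    have "1 - \<epsilon> < 1 - suminf e" using e by simp
    also have "\<dots> \<le> 1 - (\<Sum>k\<le>n. e k)"
      using sum_le_suminf[OF e(2), of "{..n}"] e(1) by simp
    also have "\<dots> \<le> 1 - (\<Sum>k\<le>n. 1 - measure (M k) {0..w k})"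
      using p by (intro diff_left_mono sum_mono) (simp add: algebra_simps)
    also have "\<dots> \<le> (\<Prod>k\<le>n. 1 - (1 - measure (M k) {0..w k}))"
      using p01 by (intro Weierstrass_prod_ineq) auto
    also have "\<dots> = (\<Prod>k\<le>n. measure (M k) {0..w k})" by simp
    also have "\<dots> \<le> measure (finite_convolution M n) {0..\<Sum>k\<le>n. w k}"
      by (rule measure_finite_convolution_ge[OF M])
    also have "\<dots> \<le> measure (finite_convolution M n) {- 1<..suminf w}"
      using sum_le_suminf[OF w(2), of "{..n}"] w(1) by (intro F.finite_measure_mono) auto
    finally show "1 - \<epsilon> < measure (finite_convolution M n) {- 1<..suminf w}" .
  qed
qed

text \<open>Tightness yields a weakly convergent subsequence, whose limit must have characteristic
  function \<open>g\<close>. Knowing now that \<open>g\<close> belongs to a distribution, Levy's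
  continuity theorem gives convergence of the whole sequence.\<close>

lemma convergent_char_imp_weak_conv:
  assumes tight: "tight M" and conv: "\<And>t. (\<lambda>n. char (M n) t) \<longlonglongrightarrow> g t"
  obtains \<nu> where "real_distribution \<nu>" "weak_conv_m M \<nu>" "char \<nu> = g"
proof -
  have M: "real_distribution (M n)" for n using tight by (simp add: tight_def)
  obtain r \<nu> where r: "strict_mono (r :: nat \<Rightarrow> nat)" and \<nu>: "real_distribution \<nu>"
      and w: "weak_conv_m (M \<circ> id \<circ> r) \<nu>"
    using tight_imp_convergent_subsubsequence[OF tight, of id] strict_mono_id by blast
  have "char \<nu> t = g t" for t
  proof (rule LIMSEQ_unique)
    show "(\<lambda>n. char ((M \<circ> id \<circ> r) n) t) \<longlonglongrightarrow> char \<nu> t"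
      using M \<nu> w by (intro levy_continuity1) (auto simp: o_def)
    show "(\<lambda>n. char ((M \<circ> id \<circ> r) n) t) \<longlonglongrightarrow> g t"
      using LIMSEQ_subseq_LIMSEQ[OF conv r] by (simp add: o_def)
  qed
  moreover from this have "weak_conv_m M \<nu>"
    using conv by (intro levy_continuity M \<nu>) auto
  ultimately show ?thesis using that \<nu> by blast
qed

section \<open>The given infinite convolution and its spectrum\<close>

context digit_system
begin

text \<open>Written as in the theorem, so that the two agree by unfolding; \<open>A_eq\<close> is
  the form used in calculations.\<close>

definition A :: "nat \<Rightarrow> real set" where
  "A k = (\<lambda>d. inverse (\<Prod>i\<le>k. real (N i)) * real d) ` B k"

lemma A_eq: "A k = (\<lambda>d. real d / real (Q (Suc k))) ` B k"
  by (simp add: A_def Q_def lessThan_Suc_atMost divide_inverse mult.commute)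

lemma inj_on_A: "inj_on (\<lambda>d. real d / real (Q (Suc k))) S"
  by (simp add: inj_on_def)

lemma finite_A: "finite (A k)"
  by (simp add: A_eq finite_B)

lemma card_A: "card (A k) = b k"
  unfolding A_eq by (simp only: card_image[OF inj_on_A] card_B)

lemma A_nonempty: "A k \<noteq> {}"
  using card_A[of k] b_pos[of k] by (metis card.empty less_irrefl)

lemma real_distribution_A: "real_distribution (uniform_delta (A k))"
  by (intro real_distribution_uniform_delta finite_A A_nonempty)

lemma char_A: "char (uniform_delta (A k)) (2 * pi * t) = D k (t / real (Q (Suc k)))"
proof -
  have "(\<Sum>a\<in>A k. iexp (2 * pi * t * a)) = (\<Sum>d\<in>B k. iexp (2 * pi * t * (real d / real (Q (Suc k)))))"
    unfolding A_eq by (simp only: sum.reindex[OF inj_on_A] o_def)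
  also have "\<dots> = (\<Sum>d\<in>B k. cis (2 * pi * real d * (t / real (Q (Suc k)))))"
    by (simp only: cis_conv_exp) (simp add: mult_ac)
  finally show ?thesis
    by (simp only: char_uniform_delta[OF finite_A] card_A D_def)
qed

lemma char_convolution_A: "char (finite_convolution (\<lambda>k. uniform_delta (A k)) n) (2 * pi * t) = phi (Suc n) t"
  by (simp add: char_finite_convolution real_distribution_A char_A phi_def lessThan_Suc_atMost)

text \<open>The digits below \<open>b k\<close> land in this window, and their proportion is
  \<open>1 - bad k\<close>.\<close>

lemma measure_A_ge: "1 - bad k \<le> measure (uniform_delta (A k)) {0..real (b k) / real (Q (Suc k))}"
proof -
  let ?f = "\<lambda>d. real d / real (Q (Suc k))"
  have "card (B k - {0..<b k}) + card (B k \<inter> {0..<b k}) = b k"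
    using card_Diff_subset_Int[of "B k" "{0..<b k}"] finite_B[of k] card_B[of k]
      card_mono[OF finite_B, of "B k \<inter> {0..<b k}" k] by auto
  then have "real (card (B k - {0..<b k})) + real (card (B k \<inter> {0..<b k})) = real (b k)"
    by (simp only: of_nat_add[symmetric])
  then have "1 - bad k = real (card (B k \<inter> {0..<b k})) / real (b k)"
    by (simp add: bad_def field_simps)
  also have "card (B k \<inter> {0..<b k}) = card (?f ` (B k \<inter> {0..<b k}))"
    by (rule card_image[OF inj_on_A, symmetric])
  also have "\<dots> \<le> card (A k \<inter> {0..real (b k) / real (Q (Suc k))})"
    by (rule card_mono) (auto simp: A_eq finite_B intro!: divide_right_mono)
  finally show ?thesis
    by (simp add: measure_uniform_delta[OF finite_A] card_A divide_right_mono)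
qed

lemma tight_A: "tight (finite_convolution (\<lambda>k. uniform_delta (A k)))"
proof (rule tight_finite_convolution[OF real_distribution_A])
  fix \<epsilon> :: real assume "\<epsilon> > 0"
  moreover have "(\<lambda>K. \<Sum>i. bad (i + K)) \<longlonglongrightarrow> 0"
    by (rule suminf_exist_split2[OF summable_bad'])
  ultimately have "eventually (\<lambda>K. (\<Sum>i. bad (i + K)) < \<epsilon>) sequentially"
    by (intro order_tendstoD)
  then obtain K where K: "(\<Sum>i. bad (i + K)) < \<epsilon>" by (auto simp: eventually_sequentially)
  \<comment> \<open>The first \<open>K\<close> factors get windows containing their whole finite
    support and lose nothing. From \<open>K\<close> on, the windows shrink geometrically and the
    losses \<open>bad k\<close> add up to less than \<open>\<epsilon>\<close>.\<close>
  define e where "e k = (if k < K then 0 else bad k)" for k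
  define w where "w k = (if k < K then Max (A k) else real (b k) / real (Q (Suc k)))" for k
  have A_nonneg: "a \<in> A k \<Longrightarrow> 0 \<le> a" for a k by (auto simp: A_eq)
  have w: "0 \<le> w k" for k
    using A_nonneg[OF Max_in[OF finite_A A_nonempty]] by (simp add: w_def)
  have "summable (\<lambda>i. w (i + K))"
  proof (rule summable_comparison_test')
    show "summable (\<lambda>i. (1 / 2 :: real) ^ i)" by (rule summable_geometric) simp
    fix i
    have "w (i + K) \<le> 1 / real (Q (i + K))"
      using b_scaled_le[of "i + K" 1] by (simp add: w_def)
    also have "\<dots> \<le> (1 / 2) ^ (i + K)" by (rule inverse_Q_le)
    also have "\<dots> \<le> (1 / 2) ^ i" by (rule power_decreasing) auto
    finally show "norm (w (i + K)) \<le> (1 / 2) ^ i" using w by simp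
  qed
  then have "summable w" by (simp only: summable_iff_shift)
  moreover have "summable e"
    by (rule summable_comparison_test'[OF summable_bad']) (simp add: e_def bad_nonneg)
  moreover have "suminf e < \<epsilon>"
  proof -
    have "suminf e = (\<Sum>i. e (i + K)) + (\<Sum>i<K. e i)"
      by (rule suminf_split_initial_segment) fact
    then show ?thesis using K by (simp add: e_def)
  qed
  moreover have "1 - e k \<le> measure (uniform_delta (A k)) {0..w k}" for k
  proof (cases "k < K")
    case True
    have "A k \<inter> {0..w k} = A k"
      using A_nonneg finite_A True by (auto simp: w_def)
    then show ?thesis
      using True by (simp add: measure_uniform_delta[OF finite_A] card_A e_def)
  next
    case False
    then show ?thesis using measure_A_ge by (simp add: e_def w_def)
  qed
  ultimately show "\<exists>w e. (\<forall>k. 0 \<le> w k) \<and> summable w \<and> (\<forall>k. 0 \<le> e k) \<and> summable e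
      \<and> suminf e < \<epsilon> \<and> (\<forall>k. 1 - e k \<le> measure (uniform_delta (A k)) {0..w k})"
    using w by (intro exI[of _ w] exI[of _ e]) (auto simp: e_def bad_nonneg)
qed

lemma infinite_convolution_A:
  obtains \<nu> where "is_infinite_convolution A \<nu>" "\<And>t. char \<nu> (2 * pi * t) = phi_lim t"
proof -
  let ?F = "finite_convolution (\<lambda>k. uniform_delta (A k))"
  have conv: "(\<lambda>n. char (?F n) t) \<longlonglongrightarrow> phi_lim (t / (2 * pi))" for t
    \<comment> \<open>The finite convolution of index \<open>n\<close> has \<open>n + 1\<close>
      factors, hence the shift by one in \<open>phi\<close>.\<close>
    using LIMSEQ_Suc[OF phi_tendsto[of "t / (2 * pi)"]] char_convolution_A[of _ "t / (2 * pi)"] by simp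
  obtain \<nu> where \<nu>: "real_distribution \<nu>" "weak_conv_m ?F \<nu>" "char \<nu> = (\<lambda>t. phi_lim (t / (2 * pi)))"
    using tight_A conv by (rule convergent_char_imp_weak_conv)
  have "converges_weakly ?F \<nu>"
    unfolding converges_weakly_def
  proof (intro allI impI, elim conjE)
    fix f :: "real \<Rightarrow> real" assume f: "continuous_on UNIV f" "bounded (range f)"
    then obtain C where C: "\<And>x. norm (f x) \<le> C" by (auto simp: bounded_iff)
    have "isCont f x" for x using f(1) by (simp add: continuous_on_eq_continuous_at)
    then show "(\<lambda>n. integral\<^sup>L (?F n) f) \<longlonglongrightarrow> integral\<^sup>L \<nu> f"
      using \<nu>(1,2) real_distribution_finite_convolution[OF real_distribution_A] C
      by (intro weak_conv_imp_integral_bdd_continuous_conv[where B = C])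
  qed
  with \<nu> show ?thesis by (intro that[of \<nu>]) (auto simp: is_infinite_convolution_def)
qed

lemma spectral_A:
  assumes \<nu>: "is_infinite_convolution A \<nu>" and char: "\<And>t. char \<nu> (2 * pi * t) = phi_lim t"
  shows "spectral_measure \<nu>"
proof -
  interpret real_distribution \<nu> using \<nu> by (simp add: is_infinite_convolution_def)
  define \<Lambda> where "\<Lambda> = real_of_int ` (\<Union>n. Lam n)"
  have "l2_orthonormal_basis \<nu> \<Lambda> expo"
  proof (rule l2_orthonormal_basis_expo)
    fix s t assume "s \<in> \<Lambda>" "t \<in> \<Lambda>" and st: "s \<noteq> t"
    then obtain l l' m m' where l: "s = of_int l" "l \<in> Lam m" "t = of_int l'" "l' \<in> Lam m'"
      unfolding \<Lambda>_def by blast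
    let ?n = "max m m'"
    have "l \<in> Lam ?n" "l' \<in> Lam ?n" using l Lam_mono[of m ?n] Lam_mono[of m' ?n] by auto
    \<comment> \<open>Both frequencies are placed in one \<open>Lam ?n\<close>; a zero of
      \<open>phi ?n\<close> is a zero of the limit because
      \<open>|phi_lim| \<le> |phi ?n|\<close>.\<close>
    then have "phi ?n (s - t) = 0" using l st Lam_orthogonal by auto
    then show "char \<nu> (2 * pi * (s - t)) = 0"
      using norm_phi_lim_le[of "s - t" ?n] by (simp add: char)
  next
    fix x \<epsilon> :: real assume "\<epsilon> > 0"
    then obtain n where n: "1 - \<epsilon> < (\<Sum>l\<in>Lam n. (cmod (phi_lim (of_int l + x)))\<^sup>2)"
      using phi_lim_complete by blast
    have "(\<Sum>s\<in>real_of_int ` Lam n. (cmod (char \<nu> (2 * pi * (s + x))))\<^sup>2) =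
        (\<Sum>l\<in>Lam n. (cmod (phi_lim (of_int l + x)))\<^sup>2)"
      by (subst sum.reindex) (auto simp: char inj_on_def)
    then show "\<exists>F. finite F \<and> F \<subseteq> \<Lambda> \<and> 1 - \<epsilon> < (\<Sum>s\<in>F. (cmod (char \<nu> (2 * pi * (s + x))))\<^sup>2)"
      using n finite_Lam by (intro exI[of _ "real_of_int ` Lam n"]) (auto simp: \<Lambda>_def)
  qed
  moreover have "countable \<Lambda>" unfolding \<Lambda>_def by auto
  ultimately show ?thesis
    unfolding spectral_measure_def expo_def[abs_def] using real_distribution_axioms by blast
qed

end

theorem theorem1p4:
  fixes b N :: "nat \<Rightarrow> nat" and B :: "nat \<Rightarrow> nat set"
  assumes "\<And>k. N k \<ge> b k" and "\<And>k. b k \<ge> 2" and "\<And>k. b k dvd N k"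
    and "nearly_consecutive b N B"
  defines "A \<equiv> \<lambda>k. (\<lambda>d. inverse (\<Prod>i\<le>k. real (N i)) * real d) ` B k"
  shows "infinite_convolution_exists A \<and> spectral_measure (infinite_convolution A)"
proof -
  interpret ds: digit_system b N B
    using assms(1-4) by unfold_locales (auto simp: nearly_consecutive_def)
  have A: "A = ds.A" by (simp add: A_def ds.A_def[abs_def])
  obtain \<nu> where \<nu>: "is_infinite_convolution ds.A \<nu>" "\<And>t. char \<nu> (2 * pi * t) = ds.phi_lim t"
    using ds.infinite_convolution_A by blast
  have "spectral_measure \<nu>" using \<nu> by (rule ds.spectral_A)
  then show ?thesis
    unfolding A infinite_convolution_exists_def using \<nu>(1) infinite_convolution_eqI by metis
qed

end
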